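(* Let $\mathcal D$ be universal with $\min(\mathcal D\setminus\{0\})=1$, let $\mathcal B$ be the block of $\mathcal D$ containing $1$, $\mathrm M=(M,d)\in\mathfrak U_{\mathcal D}$, $S\subseteq M$, and $r\in\mathcal B$ with $r>1$. Let $\mathfrak q$ be a Katětov function of $\mathrm M$ with $\operatorname{rank}(\mathfrak q)=r$ that is extendible into $S$ on $\mathrm M$. Then there exists a copy $\mathrm C=(C,d)$ of $\mathrm M$ in $\mathrm M$ with $\operatorname{dom}(\mathfrak q)\subseteq C$ and $\operatorname{orb}_C(\mathfrak q)\subseteq S$.
   Context: $\mathcal D$ is a finite subset of $\mathbb R_{\ge0}$ containing $0$. $\mathfrak U_{\mathcal D}$ is the class of countable homogeneous metric spaces (every isometry between finite subspaces extends to an isometry of the space onto itself) with distance set exactly $\mathcal D$ into which every finite metric space with distances in $\mathcal D$ embeds isometrically; $\mathcal D$ is universal if this class is nonempty. A copy of $\mathrm M$ in $\mathrm M$ is the image of an isometric embedding of $\mathrm M$ into itself. For $r\in\mathcal D$ with $r<\max\mathcal D$, $r^{+}$ is the smallest element of $\mathcal D$ larger than $r$ ($r^+=r$ if $r=\max\mathcal D$); for $r>0$, $r^{-}$ is the largest element of $\mathcal D$ smaller than $r$. A block of $\mathcal D$ is a nonempty set $\mathcal B=\{b_0<b_1<\dots<b_n\}\subseteq\mathcal D\setminus\{0\}$ such that $b_0>2b_0^{-}$, $b_{i+1}=b_i^{+}$ for all $i<n$, and $b_i+b_0\ge b_{i+1}$ for all $i<n$. A Katětov function of $\mathrm M$ is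 a map $\mathfrak t:F\to\mathcal D\setminus\{0\}$, $F\subseteq M$ finite, with $|\mathfrak t(x)-\mathfrak t(y)|\le d(x,y)\le\mathfrak t(x)+\mathfrak t(y)$ for all $x,y\in F$; $\operatorname{orb}_M(\mathfrak t)=\{y\in M\setminus F: d(y,x)=\mathfrak t(x)\ \forall x\in F\}$, for $H\supseteq F$, $\operatorname{orb}_H(\mathfrak t)=\operatorname{orb}_M(\mathfrak t)\cap H$; $\operatorname{rank}(\mathfrak t)=\min_{x\in F}\mathfrak t(x)$. A Katětov function $\mathfrak p$ of $\mathrm M$ with $\operatorname{rank}(\mathfrak p)=r$ is extendible into $S$ on $\mathrm M$ if for every copy $\mathrm H=(H,d)$ of $\mathrm M$ in $\mathrm M$ with $\operatorname{dom}(\mathfrak p)\subseteq H$ and every Katětov function $\mathfrak p'$ with $\operatorname{dom}(\mathfrak p')\subseteq H$, $\mathfrak p\subseteq\mathfrak p'$ and $\operatorname{rank}(\mathfrak p')=r$, there exist an isometric embedding $\alpha$ of $\mathrm H$ into $\mathrm H$ with $\alpha(x)=x$ for all $x\in\operatorname{dom}(\mathfrak p')$ and a Katětov function $\mathfrak g$ with $\operatorname{dom}(\mathfrak g)\subseteq\alpha(H)$, $\mathfrak p'\subseteq\mathfrak g$, $\operatorname{rank}(\mathfrak g)=r^{-}$ and $\operatorname{orb}_{\alpha(H)}(\mathfrak g)\subseteq S$. *)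

theory Defs
  imports Complex_Main "HOL-Library.Countable_Set"
begin

definition dpred :: "real set \<Rightarrow> real \<Rightarrow> real" where
  "dpred D r = Max {s \<in> D. s < r}"

definition dsucc :: "real set \<Rightarrow> real \<Rightarrow> real" where
  "dsucc D r = (if r = Max D then r else Min {s \<in> D. r < s})"

definition is_block :: "real set \<Rightarrow> real set \<Rightarrow> bool" where
  "is_block D B \<longleftrightarrow> B \<noteq> {} \<and> finite B \<and> B \<subseteq> D - {0} \<and>
     Min B > 2 * dpred D (Min B) \<and>
     (\<forall>b\<in>B. b \<noteq> Max B \<longrightarrow> dsucc D b \<in> B \<and> dsucc D b \<le> b + Min B) \<and>
     (\<forall>s\<in>D. Min B \<le> s \<and> s \<le> Max B \<longrightarrow> s \<in> B)"

definition metric_on :: "'a set \<Rightarrow> ('a \<Rightarrow> 'a \<Rightarrow> real) \<Rightarrow> bool" where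
  "metric_on M d \<longleftrightarrow> (\<forall>x\<in>M. \<forall>y\<in>M. d x y = d y x \<and> (d x y = 0 \<longleftrightarrow> x = y) \<and> d x y \<ge> 0 \<and>
      (\<forall>z\<in>M. d x z \<le> d x y + d y z))"

definition dist_set :: "'a set \<Rightarrow> ('a \<Rightarrow> 'a \<Rightarrow> real) \<Rightarrow> real set" where
  "dist_set M d = {d x y | x y. x \<in> M \<and> y \<in> M}"

definition isom_emb :: "'a set \<Rightarrow> ('a \<Rightarrow> 'a \<Rightarrow> real) \<Rightarrow> 'b set \<Rightarrow> ('b \<Rightarrow> 'b \<Rightarrow> real)
    \<Rightarrow> ('a \<Rightarrow> 'b) \<Rightarrow> bool" where
  "isom_emb A dA B dB f \<longleftrightarrow> f ` A \<subseteq> B \<and> (\<forall>x\<in>A. \<forall>y\<in>A. dB (f x) (f y) = dA x y)"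

definition homogeneous :: "'a set \<Rightarrow> ('a \<Rightarrow> 'a \<Rightarrow> real) \<Rightarrow> bool" where
  "homogeneous M d \<longleftrightarrow> (\<forall>A B f. finite A \<and> A \<subseteq> M \<and> B \<subseteq> M \<and> bij_betw f A B \<and>
      (\<forall>x\<in>A. \<forall>y\<in>A. d (f x) (f y) = d x y) \<longrightarrow>
      (\<exists>g. bij_betw g M M \<and> (\<forall>x\<in>M. \<forall>y\<in>M. d (g x) (g y) = d x y) \<and> (\<forall>x\<in>A. g x = f x)))"

text \<open>Every finite metric space with distances in D is (up to isometry) a metric on some
  initial segment of the naturals.\<close>
definition finitely_universal :: "real set \<Rightarrow> 'a set \<Rightarrow> ('a \<Rightarrow> 'a \<Rightarrow> real) \<Rightarrow> bool" where
  "finitely_universal D M d \<longleftrightarrow> (\<forall>(n::nat) (\<delta>::nat \<Rightarrow> nat \<Rightarrow> real).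
      metric_on {..<n} \<delta> \<and> dist_set {..<n} \<delta> \<subseteq> D \<longrightarrow> (\<exists>f. isom_emb {..<n} \<delta> M d f))"

definition in_U :: "real set \<Rightarrow> 'a set \<Rightarrow> ('a \<Rightarrow> 'a \<Rightarrow> real) \<Rightarrow> bool" where
  "in_U D M d \<longleftrightarrow> countable M \<and> metric_on M d \<and> homogeneous M d \<and> dist_set M d = D \<and>
      finitely_universal D M d"

definition universal_dset :: "real set \<Rightarrow> bool" where
  "universal_dset D \<longleftrightarrow> (\<exists>(M::nat set) d. in_U D M d)"

definition copy_of :: "'a set \<Rightarrow> ('a \<Rightarrow> 'a \<Rightarrow> real) \<Rightarrow> 'a set \<Rightarrow> bool" where
  "copy_of M d C \<longleftrightarrow> (\<exists>f. isom_emb M d M d f \<and> C = f ` M)"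

definition katetov :: "real set \<Rightarrow> 'a set \<Rightarrow> ('a \<Rightarrow> 'a \<Rightarrow> real) \<Rightarrow> ('a \<rightharpoonup> real) \<Rightarrow> bool" where
  "katetov D M d t \<longleftrightarrow> finite (dom t) \<and> dom t \<noteq> {} \<and> dom t \<subseteq> M \<and> ran t \<subseteq> D - {0} \<and>
     (\<forall>x\<in>dom t. \<forall>y\<in>dom t. \<bar>the (t x) - the (t y)\<bar> \<le> d x y \<and> d x y \<le> the (t x) + the (t y))"

definition orb :: "'a set \<Rightarrow> ('a \<Rightarrow> 'a \<Rightarrow> real) \<Rightarrow> ('a \<rightharpoonup> real) \<Rightarrow> 'a set" where
  "orb M d t = {y \<in> M - dom t. \<forall>x\<in>dom t. d y x = the (t x)}"

definition rank :: "('a \<rightharpoonup> real) \<Rightarrow> real" where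
  "rank t = Min (ran t)"

definition extendible_into :: "real set \<Rightarrow> 'a set \<Rightarrow> ('a \<Rightarrow> 'a \<Rightarrow> real) \<Rightarrow> 'a set
    \<Rightarrow> ('a \<rightharpoonup> real) \<Rightarrow> bool" where
  "extendible_into D M d S p \<longleftrightarrow> katetov D M d p \<and>
     (\<forall>H p'. copy_of M d H \<and> dom p \<subseteq> H \<and> katetov D M d p' \<and> dom p' \<subseteq> H \<and> p \<subseteq>\<^sub>m p' \<and>
        rank p' = rank p \<longrightarrow>
        (\<exists>\<alpha>. isom_emb H d H d \<alpha> \<and> (\<forall>x\<in>dom p'. \<alpha> x = x) \<and>
           (\<exists>g. katetov D M d g \<and> dom g \<subseteq> \<alpha> ` H \<and> p' \<subseteq>\<^sub>m g \<and> rank g = dpred D (rank p) \<and>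
                orb M d g \<inter> \<alpha> ` H \<subseteq> S)))"

end

theory Submission
  imports Defs "HOL-Library.FuncSet"
begin

text \<open>An isometric embedding f of M is built one point at a time, inside a decreasing sequence of
  copies H. Choosing f y greedily for y in orb(q) fails when y is at distance less than r from an
  earlier point x, because extendibility only speaks about types of rank r. So before f x is chosen,
  one fixes for each of the finitely many types over the earlier points and x, of distance at
  least r to the former and less than r to x, a set of target distances that forces f y into S:
  the current distances of y are raised to at least r, which costs at most 1 because r lies in the
  block of 1, and extendibility is applied to the result. Amalgamating the
  finite witness with the metric space glued from M and the part of the target used so far
  leaves room for all the points still to come.\<close>

text \<open>Two estimates fix the role of r and its predecessor r'. Points of one of the types to be
  forced are within r' of x, hence within 2 r' of each other, so a witness all of whose values are
  at least r' can be the common distance function of the whole type. This is where the rank r^- in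
  extendibility is used. The obstacle is the raising: only one type is raised, and a point y' of
  another type keeps its distances, although the cross distances must stay 1-Lipschitz. This is what
  the following invariant is for: a cross distance \<open>G y e\<close> is at least r', or at least
  the distance from y to a point already placed. In the first case at y' a positive distance from y
  to y' makes up for the raise; in the second the triangle inequality does, since y is at distance
  at least r from every placed point. Both this bound and the dependence on types alone survive
  amalgamation because every new cross distance is the truncated length of an explicit path through
  the common part.\<close>

definition osum :: "real set \<Rightarrow> real \<Rightarrow> real \<Rightarrow> real" where
  "osum D a b = Max {s \<in> D. s \<le> a + b}"

text \<open>Distance 0 between different points is allowed because the glued space contains a source
  point and its image as two points at distance 0.\<close>

definition pseudometric :: "real set \<Rightarrow> 'b set \<Rightarrow> ('b \<Rightarrow> 'b \<Rightarrow> real) \<Rightarrow> bool" where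
  "pseudometric D A \<rho> \<longleftrightarrow> (\<forall>x\<in>A. \<forall>y\<in>A. \<rho> x y \<in> D \<and> \<rho> x x = 0 \<and> \<rho> x y = \<rho> y x \<and>
     (\<forall>z\<in>A. \<rho> x z \<le> \<rho> x y + \<rho> y z))"

text \<open>The shortest-path distance through the common part C, with lengths truncated so that it
  stays in D. C may be infinite: the truncated lengths take finitely many values, so the minimum is
  attained.\<close>

definition cross_dist ::
    "real set \<Rightarrow> 'b set \<Rightarrow> ('b \<Rightarrow> 'b \<Rightarrow> real) \<Rightarrow> ('b \<Rightarrow> 'b \<Rightarrow> real) \<Rightarrow> 'b \<Rightarrow> 'b \<Rightarrow> real" where
  "cross_dist D C \<rho> \<rho>' x y = Min ((\<lambda>c. osum D (\<rho> x c) (\<rho>' c y)) ` C)"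

section \<open>Truncated addition on a finite distance set\<close>

locale distance_set =
  fixes D :: "real set"
  assumes finite_D: "finite D" and zero_D: "0 \<in> D" and nonneg_D: "x \<in> D \<Longrightarrow> 0 \<le> x"
begin

lemma osum_props:
  assumes "a \<in> D" "b \<in> D"
  shows osum_in: "osum D a b \<in> D" and osum_le: "osum D a b \<le> a + b"
proof -
  have "finite {s \<in> D. s \<le> a + b}" "0 \<in> {s \<in> D. s \<le> a + b}"
    using finite_D zero_D nonneg_D[OF assms(1)] nonneg_D[OF assms(2)] by auto
  then have "Max {s \<in> D. s \<le> a + b} \<in> {s \<in> D. s \<le> a + b}"
    by (intro Max_in) auto
  then show "osum D a b \<in> D" "osum D a b \<le> a + b"
    by (auto simp: osum_def)
qed

lemma osum_ge: "s \<in> D \<Longrightarrow> s \<le> a + b \<Longrightarrow> s \<le> osum D a b"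
  unfolding osum_def by (rule Max_ge) (auto simp: finite_D)

lemma osum_commute: "osum D a b = osum D b a"
  by (simp add: osum_def add.commute)

lemma osum_mono:
  "a \<in> D \<Longrightarrow> b \<in> D \<Longrightarrow> a \<le> a' \<Longrightarrow> b \<le> b' \<Longrightarrow> osum D a b \<le> osum D a' b'"
  using osum_in[of a b] osum_le[of a b] by (intro osum_ge) auto

lemma osum_ge_left: "a \<in> D \<Longrightarrow> b \<in> D \<Longrightarrow> a \<le> osum D a b"
  and osum_ge_right: "a \<in> D \<Longrightarrow> b \<in> D \<Longrightarrow> b \<le> osum D a b"
  by (auto intro!: osum_ge simp: nonneg_D)

lemma osum_0_left: "a \<in> D \<Longrightarrow> osum D 0 a = a"
  using osum_le[OF zero_D, of a] osum_ge_right[OF zero_D, of a] by simp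

lemma osum_0_right: "a \<in> D \<Longrightarrow> osum D a 0 = a"
  using osum_0_left osum_commute by metis

end

lemma pseudometricD:
  assumes "pseudometric D A \<rho>" "x \<in> A" "y \<in> A"
  shows "\<rho> x y \<in> D" "\<rho> x x = 0" "\<rho> x y = \<rho> y x"
    and "z \<in> A \<Longrightarrow> \<rho> x z \<le> \<rho> x y + \<rho> y z"
  using assms unfolding pseudometric_def by blast+

text \<open>Associativity of the truncated sum is the four-values condition, equivalent to the amalgamation
  property of the finite metric spaces with distances in D.\<close>

locale associative_distance_set = distance_set +
  assumes osum_assoc:
    "a \<in> D \<Longrightarrow> b \<in> D \<Longrightarrow> c \<in> D \<Longrightarrow> osum D (osum D a b) c = osum D a (osum D b c)"

section \<open>Amalgamation of two pseudometric spaces over a common part\<close>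

locale amalgamation = associative_distance_set D for D +
  fixes A B :: "'b set" and \<rho>A \<rho>B :: "'b \<Rightarrow> 'b \<Rightarrow> real"
  assumes psA: "pseudometric D A \<rho>A" and psB: "pseudometric D B \<rho>B"
    and agree: "x \<in> A \<Longrightarrow> x \<in> B \<Longrightarrow> y \<in> A \<Longrightarrow> y \<in> B \<Longrightarrow> \<rho>A x y = \<rho>B x y"
    and nonempty: "A \<inter> B \<noteq> {}"
begin

abbreviation \<kappa> where "\<kappa> \<equiv> cross_dist D (A \<inter> B) \<rho>A \<rho>B"

lemma finite_image:
  assumes "x \<in> A" "y \<in> B"
  shows "finite ((\<lambda>c. osum D (\<rho>A x c) (\<rho>B c y)) ` (A \<inter> B))"
  using assms by (intro finite_subset[OF _ finite_D])
    (auto intro!: osum_in pseudometricD(1)[OF psA] pseudometricD(1)[OF psB])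

lemma cross_dist_attained:
  assumes "x \<in> A" "y \<in> B"
  obtains c where "c \<in> A" "c \<in> B" "\<kappa> x y = osum D (\<rho>A x c) (\<rho>B c y)"
proof -
  have "\<kappa> x y \<in> (\<lambda>c. osum D (\<rho>A x c) (\<rho>B c y)) ` (A \<inter> B)"
    unfolding cross_dist_def using finite_image[OF assms] nonempty by (intro Min_in) auto
  then show ?thesis using that by auto
qed

lemma cross_dist_le:
  assumes "x \<in> A" "y \<in> B" "c \<in> A" "c \<in> B"
  shows "\<kappa> x y \<le> osum D (\<rho>A x c) (\<rho>B c y)"
  unfolding cross_dist_def using finite_image[OF assms(1,2)] assms(3,4) by (intro Min_le) auto

lemma cross_dist_in:
  assumes "x \<in> A" "y \<in> B"
  shows "\<kappa> x y \<in> D"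
proof -
  obtain c where "c \<in> A" "c \<in> B" "\<kappa> x y = osum D (\<rho>A x c) (\<rho>B c y)"
    using cross_dist_attained assms by metis
  with assms show ?thesis
    using osum_in pseudometricD(1)[OF psA] pseudometricD(1)[OF psB] by simp
qed

lemma cross_dist_left:
  assumes "x \<in> A" "x \<in> B" "y \<in> B"
  shows "\<kappa> x y = \<rho>B x y"
proof (rule antisym)
  show "\<kappa> x y \<le> \<rho>B x y"
    using cross_dist_le[OF assms(1,3,1,2)] pseudometricD(2)[OF psA assms(1,1)]
      pseudometricD(1)[OF psB assms(2,3)] by (simp add: osum_0_left)
  obtain c where c: "c \<in> A" "c \<in> B" "\<kappa> x y = osum D (\<rho>A x c) (\<rho>B c y)"
    using cross_dist_attained assms by metis
  then show "\<rho>B x y \<le> \<kappa> x y"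
    using pseudometricD(1)[OF psB, of x y] pseudometricD(4)[OF psB, of x c y]
      assms agree[of x c] by (auto intro!: osum_ge)
qed

lemma cross_dist_right:
  assumes "x \<in> A" "y \<in> A" "y \<in> B"
  shows "\<kappa> x y = \<rho>A x y"
proof (rule antisym)
  show "\<kappa> x y \<le> \<rho>A x y"
    using cross_dist_le[OF assms(1,3,2,3)] pseudometricD(2)[OF psB assms(3,3)]
      pseudometricD(1)[OF psA assms(1,2)] by (simp add: osum_0_right)
  obtain c where c: "c \<in> A" "c \<in> B" "\<kappa> x y = osum D (\<rho>A x c) (\<rho>B c y)"
    using cross_dist_attained assms by metis
  then show "\<rho>A x y \<le> \<kappa> x y"
    using pseudometricD(1)[OF psA, of x y] pseudometricD(4)[OF psA, of x c y]
      assms agree[of c y] by (auto intro!: osum_ge)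
qed

text \<open>Prolong an optimal path from x' to y by the step from x to x'. Truncation happens first
  at the initial two legs, whereas the bound needs it first at the last two; associativity exchanges
  the two orders.\<close>

lemma cross_dist_triangle1:
  assumes x: "x \<in> A" and x': "x' \<in> A" and y: "y \<in> B"
  shows "\<kappa> x y \<le> \<rho>A x x' + \<kappa> x' y"
proof -
  obtain c where c: "c \<in> A" "c \<in> B" "\<kappa> x' y = osum D (\<rho>A x' c) (\<rho>B c y)"
    using cross_dist_attained x' y by metis
  have D: "\<rho>A x c \<in> D" "\<rho>A x x' \<in> D" "\<rho>A x' c \<in> D" "\<rho>B c y \<in> D"
    using x x' y c pseudometricD(1)[OF psA] pseudometricD(1)[OF psB] by auto
  have "\<kappa> x y \<le> osum D (\<rho>A x c) (\<rho>B c y)"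
    using cross_dist_le x y c by blast
  also have "\<dots> \<le> osum D (osum D (\<rho>A x x') (\<rho>A x' c)) (\<rho>B c y)"
    using D pseudometricD(4)[OF psA x x' c(1)] by (intro osum_mono osum_ge) auto
  also have "\<dots> = osum D (\<rho>A x x') (\<kappa> x' y)"
    using osum_assoc D c by simp
  also have "\<dots> \<le> \<rho>A x x' + \<kappa> x' y"
    using osum_le D c osum_in by simp
  finally show ?thesis .
qed

text \<open>The closed route x, c, y, c', x' is shortened to x, c, c', x', where the middle leg may
  be measured on either side. Associativity regroups the nested truncated sum into the two optimal
  halves.\<close>

lemma cross_dist_triangle2:
  assumes x: "x \<in> A" and x': "x' \<in> A" and y: "y \<in> B"
  shows "\<rho>A x x' \<le> \<kappa> x y + \<kappa> x' y"
proof -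
  obtain c where c: "c \<in> A" "c \<in> B" "\<kappa> x y = osum D (\<rho>A x c) (\<rho>B c y)"
    using cross_dist_attained x y by metis
  obtain c' where c': "c' \<in> A" "c' \<in> B" "\<kappa> x' y = osum D (\<rho>A x' c') (\<rho>B c' y)"
    using cross_dist_attained x' y by metis
  let ?a = "\<rho>A x c" and ?b = "\<rho>B c y" and ?b' = "\<rho>B c' y" and ?a' = "\<rho>A x' c'"
  have D: "?a \<in> D" "?b \<in> D" "?a' \<in> D" "?b' \<in> D" "\<rho>A c c' \<in> D" "\<rho>A c x' \<in> D" "\<rho>A x x' \<in> D"
    using x x' y c c' pseudometricD(1)[OF psA] pseudometricD(1)[OF psB] by auto
  have "\<rho>A c c' \<le> ?b + ?b'"
    using pseudometricD(4)[OF psB c(2) y c'(2)] agree[OF c(1,2) c'(1,2)]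
      pseudometricD(3)[OF psB y c'(2)] by simp
  then have 1: "\<rho>A c c' \<le> osum D ?b ?b'"
    using D by (intro osum_ge)
  have "\<rho>A c x' \<le> \<rho>A c c' + ?a'"
    using pseudometricD(4)[OF psA c(1) c'(1) x'] pseudometricD(3)[OF psA c'(1) x'] by simp
  then have 2: "\<rho>A c x' \<le> osum D (osum D ?b ?b') ?a'"
    using D 1 osum_in by (intro osum_ge) auto
  have "\<rho>A x x' \<le> ?a + \<rho>A c x'"
    using pseudometricD(4)[OF psA x c(1) x'] by simp
  then have "\<rho>A x x' \<le> osum D ?a (osum D (osum D ?b ?b') ?a')"
    using D 2 by (intro osum_ge) auto
  also have "\<dots> = osum D (osum D ?a ?b) (osum D ?a' ?b')"
    using D by (simp add: osum_assoc osum_in osum_commute[of ?a' ?b'])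
  also have "\<dots> \<le> \<kappa> x y + \<kappa> x' y"
    using D c c' osum_le osum_in by simp
  finally show ?thesis .
qed

lemma amalgamation_swap: "amalgamation D B A \<rho>B \<rho>A"
  by unfold_locales (use psA psB agree nonempty in auto)

lemma cross_dist_swap:
  assumes "x \<in> A" "y \<in> B"
  shows "cross_dist D (B \<inter> A) \<rho>B \<rho>A y x = \<kappa> x y"
proof -
  have "osum D (\<rho>B y c) (\<rho>A c x) = osum D (\<rho>A x c) (\<rho>B c y)" if "c \<in> A \<inter> B" for c
    using that assms pseudometricD(3)[OF psA] pseudometricD(3)[OF psB] osum_commute
    by (metis IntD1 IntD2)
  then show ?thesis
    unfolding cross_dist_def by (intro arg_cong[where f = Min] image_cong) auto
qed

lemma amalgam:
  obtains \<rho> where "pseudometric D (A \<union> B) \<rho>"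
    and "\<And>x y. x \<in> A \<Longrightarrow> y \<in> A \<Longrightarrow> \<rho> x y = \<rho>A x y"
    and "\<And>x y. x \<in> B \<Longrightarrow> y \<in> B \<Longrightarrow> \<rho> x y = \<rho>B x y"
    and "\<And>x y. x \<in> A \<Longrightarrow> y \<in> B \<Longrightarrow> \<rho> x y = \<kappa> x y"
proof -
  \<comment> \<open>Exchanging the two sides yields the triangle inequalities with two points in B
    from those with two points in A.\<close>
  interpret s: amalgamation D B A \<rho>B \<rho>A by (rule amalgamation_swap)
  define \<rho> where "\<rho> x y = (if x \<in> A \<and> y \<in> A then \<rho>A x y else if x \<in> B \<and> y \<in> B then \<rho>B x y
    else if x \<in> A then \<kappa> x y else \<kappa> y x)" for x y
  have AA: "\<rho> x y = \<rho>A x y" if "x \<in> A" "y \<in> A" for x y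
    using that by (simp add: \<rho>_def)
  have BB: "\<rho> x y = \<rho>B x y" if "x \<in> B" "y \<in> B" for x y
    using that agree by (auto simp: \<rho>_def)
  have AB: "\<rho> x y = \<kappa> x y" if "x \<in> A" "y \<in> B" for x y
    using that cross_dist_left cross_dist_right by (auto simp: \<rho>_def)
  have BA: "\<rho> y x = \<kappa> x y" if "x \<in> A" "y \<in> B" for x y
    using that cross_dist_left[of x y] cross_dist_right[of x y]
      pseudometricD(3)[OF psA] pseudometricD(3)[OF psB]
    by (auto simp: \<rho>_def)
  note tA1 = cross_dist_triangle1 and tA2 = cross_dist_triangle2
  have tB1: "\<kappa> x y \<le> \<kappa> x y' + \<rho>B y' y" if "x \<in> A" "y \<in> B" "y' \<in> B" for x y y'
    using s.cross_dist_triangle1[of y y' x] that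
    by (simp add: cross_dist_swap pseudometricD(3)[OF psB, of y y'])
  have tB2: "\<rho>B y y' \<le> \<kappa> x y + \<kappa> x y'" if "x \<in> A" "y \<in> B" "y' \<in> B" for x y y'
    using s.cross_dist_triangle2[of y y' x] that by (simp add: cross_dist_swap)
  have sA: "\<rho>A x y = \<rho>A y x" if "x \<in> A" "y \<in> A" for x y
    using pseudometricD(3)[OF psA] that by blast
  have sB: "\<rho>B x y = \<rho>B y x" if "x \<in> B" "y \<in> B" for x y
    using pseudometricD(3)[OF psB] that by blast
  have sym: "\<rho> x y = \<rho> y x" if "x \<in> A \<union> B" "y \<in> A \<union> B" for x y
    using that by (elim UnE) (simp_all add: AA BB AB BA sA sB)
  have tri: "\<rho> x z \<le> \<rho> x y + \<rho> y z" if xyz: "x \<in> A \<union> B" "y \<in> A \<union> B" "z \<in> A \<union> B" for x y z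
  proof -
    consider "x \<in> A" "y \<in> A" "z \<in> A" | "x \<in> A" "y \<in> A" "z \<in> B" | "x \<in> A" "y \<in> B" "z \<in> A"
      | "x \<in> A" "y \<in> B" "z \<in> B" | "x \<in> B" "y \<in> A" "z \<in> A" | "x \<in> B" "y \<in> A" "z \<in> B"
      | "x \<in> B" "y \<in> B" "z \<in> A" | "x \<in> B" "y \<in> B" "z \<in> B"
      using xyz by blast
    then show ?thesis
    proof cases
      case 1 then show ?thesis using pseudometricD(4)[OF psA] by (simp add: AA)
    next
      case 2 then show ?thesis using tA1[of x y z] by (simp add: AA AB)
    next
      case 3 then show ?thesis using tA2[of x z y] by (simp add: AA AB BA)
    next
      case 4 then show ?thesis using tB1[of x z y] by (simp add: AB BB)
    next
      case 5 then show ?thesis using tA1[of z y x] sA[of y z] by (simp add: AA BA)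
    next
      case 6 then show ?thesis using tB2[of y x z] by (simp add: BB AB BA)
    next
      case 7 then show ?thesis using tB1[of z x y] sB[of x y] by (simp add: BB BA)
    next
      case 8 then show ?thesis using pseudometricD(4)[OF psB] by (simp add: BB)
    qed
  qed
  have mem: "\<rho> x y \<in> D" if "x \<in> A \<union> B" "y \<in> A \<union> B" for x y
    using that by (elim UnE) (simp_all add: AA BB AB BA cross_dist_in
        pseudometricD(1)[OF psA] pseudometricD(1)[OF psB])
  have "\<rho> x x = 0" if "x \<in> A \<union> B" for x
    using that by (elim UnE) (simp_all add: AA BB pseudometricD(2)[OF psA] pseudometricD(2)[OF psB])
  with sym tri mem have "pseudometric D (A \<union> B) \<rho>"
    unfolding pseudometric_def by blast
  then show ?thesis using that AA BB AB by blast
qed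

end

section \<open>Extension properties of M, and associativity of the truncated sum\<close>

locale urysohn_space = distance_set D for D +
  fixes M :: "'a set" and d :: "'a \<Rightarrow> 'a \<Rightarrow> real"
  assumes in_U: "in_U D M d"
begin

lemma d_in: "x \<in> M \<Longrightarrow> y \<in> M \<Longrightarrow> d x y \<in> D"
  using in_U by (auto simp: in_U_def dist_set_def)

lemma d_self: "x \<in> M \<Longrightarrow> d x x = 0"
  and d_commute: "x \<in> M \<Longrightarrow> y \<in> M \<Longrightarrow> d x y = d y x"
  and d_eq_0: "x \<in> M \<Longrightarrow> y \<in> M \<Longrightarrow> d x y = 0 \<Longrightarrow> x = y"
  and d_triangle: "x \<in> M \<Longrightarrow> y \<in> M \<Longrightarrow> z \<in> M \<Longrightarrow> d x z \<le> d x y + d y z"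
  using in_U unfolding in_U_def metric_on_def by blast+

lemma d_nonneg: "x \<in> M \<Longrightarrow> y \<in> M \<Longrightarrow> 0 \<le> d x y"
  using d_in nonneg_D by blast

lemma M_nonempty: "M \<noteq> {}"
  using in_U zero_D by (auto simp: in_U_def dist_set_def)

lemma extend_isometry:
  assumes "finite A" "A \<subseteq> M" "f ` A \<subseteq> M" "\<And>x y. x \<in> A \<Longrightarrow> y \<in> A \<Longrightarrow> d (f x) (f y) = d x y"
  shows "\<exists>g. bij_betw g M M \<and> (\<forall>x\<in>M. \<forall>y\<in>M. d (g x) (g y) = d x y) \<and> (\<forall>x\<in>A. g x = f x)"
proof -
  have "inj_on f A"
    using assms d_eq_0 d_self by (intro inj_onI) (metis subset_iff)
  then have "bij_betw f A (f ` A)"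
    by (rule inj_on_imp_bij_betw)
  moreover have "homogeneous M d"
    using in_U by (simp add: in_U_def)
  ultimately show ?thesis
    using assms unfolding homogeneous_def by (elim allE[of _ A] allE[of _ "f ` A"] allE[of _ f]) simp
qed

lemma one_point_extension:
  assumes fin: "finite A" and AM: "A \<subseteq> M" and pD: "\<And>x. x \<in> A \<Longrightarrow> p x \<in> D"
    and kat: "\<And>x y. x \<in> A \<Longrightarrow> y \<in> A \<Longrightarrow> \<bar>p x - p y\<bar> \<le> d x y \<and> d x y \<le> p x + p y"
  shows "\<exists>y\<in>M. \<forall>a\<in>A. d y a = p a"
proof (cases "\<exists>a\<in>A. p a = 0")
  case True
  then obtain a where a: "a \<in> A" "p a = 0" by blast
  have "d a x = p x" if "x \<in> A" for x
    using kat[OF a(1) that] a(2) nonneg_D[OF pD[OF that]] by simp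
  with a AM show ?thesis by blast
next
  case False
  define n where "n = card A"
  obtain e where e: "bij_betw e {..<n} A"
    using ex_bij_betw_nat_finite[OF fin] by (auto simp: n_def atLeast0LessThan)
  then have eA: "e i \<in> A" "e i \<in> M" if "i < n" for i
    using that AM by (auto simp: bij_betw_def)
  have e_eq_0: "d (e i) (e j) = 0 \<longleftrightarrow> i = j" if "i < n" "j < n" for i j
    using e that d_self[of "e i"] d_eq_0[of "e i" "e j"] eA by (auto simp: bij_betw_def inj_on_def)
  \<comment> \<open>The indices below n enumerate A; the index n is the new point.\<close>
  define \<delta> where "\<delta> i j = (if i < n \<and> j < n then d (e i) (e j) else if i < n then p (e i)
    else if j < n then p (e j) else 0)" for i j
  have pos: "0 < p (e i)" if "i < n" for i
    using False eA(1)[OF that] nonneg_D[OF pD[OF eA(1)[OF that]]]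
    by (metis less_eq_real_def)
  have lip: "p (e i) \<le> d (e i) (e j) + p (e j)" "d (e i) (e j) \<le> p (e i) + p (e j)"
    if "i < n" "j < n" for i j
    using kat[OF eA(1)[OF that(1)] eA(1)[OF that(2)]] by auto
  have "metric_on {..<Suc n} \<delta>"
    unfolding metric_on_def
  proof (intro ballI conjI)
    fix i j k assume "i \<in> {..<Suc n}" "j \<in> {..<Suc n}" "k \<in> {..<Suc n}"
    then have ij: "i < n \<or> i = n" "j < n \<or> j = n" "k < n \<or> k = n" by auto
    show "\<delta> i j = \<delta> j i"
      using ij d_commute eA by (auto simp: \<delta>_def)
    show "\<delta> i j = 0 \<longleftrightarrow> i = j"
      using ij pos e_eq_0 by (auto simp: \<delta>_def dest: pos)
    show "0 \<le> \<delta> i j"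
      using ij d_nonneg eA pos by (auto simp: \<delta>_def intro: less_imp_le)
    show "\<delta> i k \<le> \<delta> i j + \<delta> j k"
      using ij lip[of i j] lip[of j k] lip[of k j] lip[of i k] d_triangle[of "e i" "e j" "e k"]
        d_commute[of "e j" "e k"] eA[of i] eA[of j] eA[of k] pos[of i] pos[of j] pos[of k]
      by (auto simp: \<delta>_def)
  qed
  moreover have "\<delta> i j \<in> D" for i j
    using d_in[of "e i" "e j"] eA[of i] eA[of j] pD[of "e i"] pD[of "e j"] zero_D
    by (simp add: \<delta>_def)
  then have "dist_set {..<Suc n} \<delta> \<subseteq> D"
    by (auto simp: dist_set_def)
  moreover have "finitely_universal D M d"
    using in_U by (simp add: in_U_def)
  ultimately obtain h where "isom_emb {..<Suc n} \<delta> M d h"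
    unfolding finitely_universal_def by blast
  then have h: "i \<le> n \<Longrightarrow> h i \<in> M" "i \<le> n \<Longrightarrow> j \<le> n \<Longrightarrow> d (h i) (h j) = \<delta> i j" for i j
    by (auto simp: isom_emb_def)
  define k where "k = e \<circ> the_inv_into {..<n} h"
  have "inj_on h {..<n}"
  proof (rule inj_onI)
    fix i j assume ij: "i \<in> {..<n}" "j \<in> {..<n}" "h i = h j"
    then have "d (e i) (e j) = 0"
      using h(2)[of i j] h(1)[of i] d_self by (simp add: \<delta>_def)
    then show "i = j"
      using ij e_eq_0 by simp
  qed
  then have k: "k (h i) = e i" if "i < n" for i
    using that by (simp add: k_def the_inv_into_f_f)
  have hM: "finite (h ` {..<n})" "h ` {..<n} \<subseteq> M" and kM: "k ` h ` {..<n} \<subseteq> M"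
    using h(1) eA(2) k by (auto simp: less_imp_le)
  have iso: "d (k x) (k y) = d x y" if "x \<in> h ` {..<n}" "y \<in> h ` {..<n}" for x y
    using that h(2) k by (auto simp: \<delta>_def less_imp_le)
  obtain g where g: "bij_betw g M M" "\<And>x y. x \<in> M \<Longrightarrow> y \<in> M \<Longrightarrow> d (g x) (g y) = d x y"
    "\<And>x. x \<in> h ` {..<n} \<Longrightarrow> g x = k x"
    using extend_isometry[OF hM kM iso] by blast
  have "d (g (h n)) a = p a" if aA: "a \<in> A" for a
  proof -
    obtain i where i: "i < n" "a = e i"
      using aA e unfolding bij_betw_def by blast
    then have "a = g (h i)" using g(3) k by simp
    then have "d (g (h n)) a = d (h n) (h i)" using i g(2) h(1) by simp
    then show ?thesis using i h(2)[of n i] by (simp add: \<delta>_def)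
  qed
  moreover have "g (h n) \<in> M"
    using g(1) h(1)[of n] by (auto simp: bij_betw_def)
  ultimately show ?thesis by blast
qed

text \<open>The map that fixes Y and sends y to y' extends to an isometry of M, and w' is the image
  of w. If y lies in Y, the equal distances force y' = y, so the map is well defined. This will
  carry a shortest path starting at y over to y'.\<close>

lemma same_type_transfer:
  assumes "finite Y" "Y \<subseteq> M" "y \<in> M" "y' \<in> M" "w \<in> M" "\<And>x. x \<in> Y \<Longrightarrow> d y x = d y' x"
  obtains w' where "w' \<in> M" "d y' w' = d y w" "\<And>x. x \<in> Y \<Longrightarrow> d w' x = d w x"
proof -
  define f where "f x = (if x \<in> Y then x else y')" for x
  have y: "y' = y" if "y \<in> Y"
    using assms that d_self[of y] d_eq_0[of y' y] by simp
  have f: "f y = y'" "\<And>x. x \<in> Y \<Longrightarrow> f x = x"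
    using y by (auto simp: f_def)
  have iso: "d (f x) (f z) = d x z" if "x \<in> insert y Y" "z \<in> insert y Y" for x z
    using that assms f d_self d_commute[of _ y] d_commute[of _ y'] by auto
  have fin: "finite (insert y Y)" and sub: "insert y Y \<subseteq> M" and im: "f ` insert y Y \<subseteq> M"
    using assms f by auto
  obtain g where g: "bij_betw g M M" "\<And>x y. x \<in> M \<Longrightarrow> y \<in> M \<Longrightarrow> d (g x) (g y) = d x y"
    "\<And>x. x \<in> insert y Y \<Longrightarrow> g x = f x"
    using extend_isometry[OF fin sub im iso] by blast
  show ?thesis
  proof
    show "g w \<in> M" using g(1) assms by (auto simp: bij_betw_def)
    show "d y' (g w) = d y w" using g f assms by (metis insertI1)
    show "d (g w) x = d w x" if "x \<in> Y" for x
      using that g f assms by (metis insertI2 subsetD)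
  qed
qed

text \<open>Amalgamate inside M two triangles with the common edge yw of length e: one with apex x
  and sides a, s, one with apex z and sides b, c. The distance from x to z belongs to D, so it is at
  most the truncated sum of a and b, while s is at most this distance plus c.\<close>

lemma osum_assoc_le:
  assumes "a \<in> D" "b \<in> D" "c \<in> D"
  shows "osum D a (osum D b c) \<le> osum D (osum D a b) c"
proof -
  define e where "e = osum D b c"
  define s where "s = osum D a e"
  have e: "e \<in> D" "e \<le> b + c" "b \<le> e" "c \<le> e"
    using assms osum_in osum_le osum_ge_left osum_ge_right by (auto simp: e_def)
  have s: "s \<in> D" "s \<le> a + e" "a \<le> s" "e \<le> s"
    using assms e osum_in osum_le osum_ge_left osum_ge_right by (auto simp: s_def)
  note nn = nonneg_D[OF assms(1)] nonneg_D[OF assms(2)] nonneg_D[OF assms(3)] nonneg_D[OF e(1)]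
  obtain y where y: "y \<in> M" using M_nonempty by blast
  obtain w where w: "w \<in> M" "d w y = e"
    using one_point_extension[of "{y}" "\<lambda>_. e"] y e nn d_self by auto
  have yw: "d y w = e" "d y y = 0" "d w w = 0" "w = y \<Longrightarrow> e = 0"
    using w y d_commute d_self by auto
  \<comment> \<open>If e = 0, the points w and y coincide and only the value at y can be prescribed;
    the other distance is then recovered from s = a, and for z from b = c = 0.\<close>
  obtain x where x: "x \<in> M" "d x y = a" "w \<noteq> y \<Longrightarrow> d x w = s"
    using one_point_extension[of "{y, w}" "\<lambda>u. if u = y then a else s"] y w yw s e nn assms
    by (fastforce split: if_splits)
  obtain z where z: "z \<in> M" "d z y = b" "w \<noteq> y \<Longrightarrow> d z w = c"
    using one_point_extension[of "{y, w}" "\<lambda>u. if u = y then b else c"] y w yw s e nn assms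
    by (fastforce split: if_splits)
  have xw: "d x w = s"
    using x s yw by (cases "w = y") auto
  have zw: "d z w = c"
    using z e yw nn by (cases "w = y") auto
  have "d x z \<le> a + b"
    using d_triangle[of x y z] d_commute[of y z] x y z by simp
  then have 1: "d x z \<le> osum D a b"
    using d_in x z by (intro osum_ge)
  have "s \<le> d x z + c"
    using d_triangle[of x z w] x z w xw zw by simp
  then have "s \<le> osum D (osum D a b) c"
    using 1 s by (intro osum_ge) auto
  then show ?thesis by (simp add: s_def e_def)
qed

sublocale associative_distance_set
proof
  fix a b c assume D: "a \<in> D" "b \<in> D" "c \<in> D"
  show "osum D (osum D a b) c = osum D a (osum D b c)"
    \<comment> \<open>By commutativity, the inequality for the reversed triple is the converse
      one.\<close>
    using osum_assoc_le[OF D] osum_assoc_le[OF D(3,2,1)] by (simp add: osum_commute)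
qed

lemma copy_subset: "copy_of M d H \<Longrightarrow> H \<subseteq> M"
  by (auto simp: copy_of_def isom_emb_def)

lemma copy_self: "copy_of M d M"
  unfolding copy_of_def isom_emb_def by (rule exI[of _ id]) auto

lemma copy_image:
  assumes "copy_of M d H" "isom_emb H d H d \<alpha>"
  shows "copy_of M d (\<alpha> ` H)"
proof -
  obtain f where f: "isom_emb M d M d f" "H = f ` M"
    using assms by (auto simp: copy_of_def)
  then have "isom_emb M d M d (\<alpha> \<circ> f)"
    using assms(2) unfolding isom_emb_def by (auto simp: image_subset_iff)
  then show ?thesis
    using f unfolding copy_of_def by (intro exI[of _ "\<alpha> \<circ> f"]) auto
qed

lemma one_point_extension_in_copy:
  assumes copy: "copy_of M d H" and fin: "finite A" and AH: "A \<subseteq> H"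
    and pD: "\<And>x. x \<in> A \<Longrightarrow> p x \<in> D"
    and kat: "\<And>x y. x \<in> A \<Longrightarrow> y \<in> A \<Longrightarrow> \<bar>p x - p y\<bar> \<le> d x y \<and> d x y \<le> p x + p y"
  shows "\<exists>y\<in>H. \<forall>a\<in>A. d y a = p a"
proof -
  obtain f where f: "f ` M \<subseteq> M" "\<And>x y. x \<in> M \<Longrightarrow> y \<in> M \<Longrightarrow> d (f x) (f y) = d x y" "H = f ` M"
    using copy by (auto simp: copy_of_def isom_emb_def)
  obtain A' where A': "A' \<subseteq> M" "finite A'" "A = f ` A'"
    using fin AH f(3) finite_subset_image by metis
  have "\<exists>y\<in>M. \<forall>a\<in>A'. d y a = (p \<circ> f) a"
  proof (rule one_point_extension)
    fix x y assume "x \<in> A'" "y \<in> A'"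
    then show "\<bar>(p \<circ> f) x - (p \<circ> f) y\<bar> \<le> d x y \<and> d x y \<le> (p \<circ> f) x + (p \<circ> f) y"
      using kat[of "f x" "f y"] f(2)[of x y] A' by (auto simp: subset_iff)
  qed (use A' pD in auto)
  then obtain y where y: "y \<in> M" "\<And>a. a \<in> A' \<Longrightarrow> d y a = p (f a)"
    by auto
  then have "d (f y) (f a) = p (f a)" if "a \<in> A'" for a
    using f(2)[of y a] A'(1) that by auto
  with y f(3) A'(3) show ?thesis by blast
qed

end

section \<open>Cross distances between a source part and a target part of M\<close>

definition sum_dist :: "('a \<Rightarrow> 'a \<Rightarrow> real) \<Rightarrow> ('a \<Rightarrow> 'a \<Rightarrow> real) \<Rightarrow> 'a + 'a \<Rightarrow> 'a + 'a \<Rightarrow> real" where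
  "sum_dist d G s t = (case s of
     Inl x \<Rightarrow> (case t of Inl x' \<Rightarrow> d x x' | Inr e \<Rightarrow> G x e)
   | Inr e \<Rightarrow> (case t of Inl x \<Rightarrow> G x e | Inr e' \<Rightarrow> d e e'))"

lemma sum_dist_simps [simp]:
  "sum_dist d G (Inl x) (Inl x') = d x x'" "sum_dist d G (Inl x) (Inr e) = G x e"
  "sum_dist d G (Inr e) (Inl x) = G x e" "sum_dist d G (Inr e) (Inr e') = d e e'"
  by (simp_all add: sum_dist_def)

context urysohn_space
begin

text \<open>The triangle inequalities that make \<open>sum_dist d G\<close> a pseudometric on
  \<open>P <+> E\<close>. A disjoint sum is needed because source and target both lie in M: one
  point may occur on both sides, at positive distance from itself. For fixed x, \<open>G x\<close>
  prescribes distances to E for an image of x.\<close>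

definition bridge :: "'a set \<Rightarrow> 'a set \<Rightarrow> ('a \<Rightarrow> 'a \<Rightarrow> real) \<Rightarrow> bool" where
  "bridge P E G \<longleftrightarrow> (\<forall>x\<in>P. \<forall>e\<in>E. G x e \<in> D \<and>
     (\<forall>x'\<in>P. G x e \<le> d x x' + G x' e \<and> d x x' \<le> G x e + G x' e) \<and>
     (\<forall>e'\<in>E. G x e \<le> G x e' + d e e' \<and> d e e' \<le> G x e + G x e'))"

lemma bridgeD:
  assumes "bridge P E G" "x \<in> P" "e \<in> E"
  shows "G x e \<in> D"
    and "x' \<in> P \<Longrightarrow> G x e \<le> d x x' + G x' e" and "x' \<in> P \<Longrightarrow> d x x' \<le> G x e + G x' e"
    and "e' \<in> E \<Longrightarrow> G x e \<le> G x e' + d e e'" and "e' \<in> E \<Longrightarrow> d e e' \<le> G x e + G x e'"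
  using assms unfolding bridge_def by blast+

lemma bridge_imp_pseudometric:
  assumes PE: "P \<subseteq> M" "E \<subseteq> M" and G: "bridge P E G"
  shows "pseudometric D (P <+> E) (sum_dist d G)"
  unfolding pseudometric_def
proof (intro ballI conjI)
  fix s t u assume stu: "s \<in> P <+> E" "t \<in> P <+> E" "u \<in> P <+> E"
  have M: "x \<in> P \<Longrightarrow> x \<in> M" "x \<in> E \<Longrightarrow> x \<in> M" for x
    using PE by auto
  show "sum_dist d G s t \<in> D"
    using stu d_in M bridgeD(1)[OF G] by (elim PlusE) auto
  show "sum_dist d G s s = 0"
    using stu d_self M by (elim PlusE) auto
  show "sum_dist d G s t = sum_dist d G t s"
    using stu d_commute M by (elim PlusE) auto
  have PPE: "G x e \<le> d x y + G y e" "G y e \<le> G x e + d x y" "d x y \<le> G x e + G y e"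
    if "x \<in> P" "y \<in> P" "e \<in> E" for x y e
    using bridgeD(2)[OF G that(1,3,2)] bridgeD(2)[OF G that(2,3,1)] bridgeD(3)[OF G that(1,3,2)]
      d_commute[of x y] M that by auto
  have PEE: "G x e \<le> d e e' + G x e'" "G x e' \<le> G x e + d e e'" "d e e' \<le> G x e + G x e'"
    if "x \<in> P" "e \<in> E" "e' \<in> E" for x e e'
    using bridgeD(4)[OF G that] bridgeD(4)[OF G that(1,3,2)] bridgeD(5)[OF G that]
      d_commute[of e e'] M that by auto
  show "sum_dist d G s u \<le> sum_dist d G s t + sum_dist d G t u"
    using stu by (elim PlusE) (simp_all add: PPE PEE M d_triangle)
qed

lemma pseudometric_imp_bridge:
  assumes PE: "P \<subseteq> M" "E \<subseteq> M" and ps: "pseudometric D (P <+> E) \<rho>"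
    and l: "\<And>x x'. x \<in> P \<Longrightarrow> x' \<in> P \<Longrightarrow> \<rho> (Inl x) (Inl x') = d x x'"
    and r: "\<And>e e'. e \<in> E \<Longrightarrow> e' \<in> E \<Longrightarrow> \<rho> (Inr e) (Inr e') = d e e'"
  shows "bridge P E (\<lambda>x e. \<rho> (Inl x) (Inr e))"
  unfolding bridge_def
proof (intro ballI conjI)
  fix x e assume xe: "x \<in> P" "e \<in> E"
  note tri = pseudometricD(4)[OF ps] and sym = pseudometricD(3)[OF ps]
  show "\<rho> (Inl x) (Inr e) \<in> D"
    using pseudometricD(1)[OF ps] xe by blast
  {
    fix x' assume x': "x' \<in> P"
    show "\<rho> (Inl x) (Inr e) \<le> d x x' + \<rho> (Inl x') (Inr e)"
      using tri[of "Inl x" "Inl x'" "Inr e"] l[OF xe(1) x'] xe x' by auto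
    show "d x x' \<le> \<rho> (Inl x) (Inr e) + \<rho> (Inl x') (Inr e)"
      using tri[of "Inl x" "Inr e" "Inl x'"] sym[of "Inr e" "Inl x'"] l[OF xe(1) x'] xe x' by auto
  }
  fix e' assume e': "e' \<in> E"
  show "\<rho> (Inl x) (Inr e) \<le> \<rho> (Inl x) (Inr e') + d e e'"
    using tri[of "Inl x" "Inr e'" "Inr e"] r[OF e' xe(2)] d_commute[of e e'] xe e' PE
    by (auto simp: subset_iff)
  show "d e e' \<le> \<rho> (Inl x) (Inr e) + \<rho> (Inl x) (Inr e')"
    using tri[of "Inr e" "Inl x" "Inr e'"] sym[of "Inr e" "Inl x"] r[OF xe(2) e'] xe e' by auto
qed

text \<open>The spaces \<open>P <+> E\<close> and \<open>Q <+> E'\<close> meet in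
  \<open>Q <+> E\<close>. The last conclusion keeps the path that attains each distance, through a
  source point of Q or a target point of E; the invariants of the gluing are checked along
  it.\<close>

lemma bridge_amalgam:
  assumes Q: "Q \<subseteq> P" "Q \<noteq> {}" and P: "P \<subseteq> M" and E: "E \<subseteq> E'" "E' \<subseteq> M"
    and G1: "bridge P E G1" and G2: "bridge Q E' G2"
    and agree: "\<And>x e. x \<in> Q \<Longrightarrow> e \<in> E \<Longrightarrow> G1 x e = G2 x e"
  obtains G where "bridge P E' G"
    and "\<And>x e. x \<in> P \<Longrightarrow> e \<in> E \<Longrightarrow> G x e = G1 x e"
    and "\<And>x e. x \<in> Q \<Longrightarrow> e \<in> E' \<Longrightarrow> G x e = G2 x e"
    and "\<And>x e. x \<in> P \<Longrightarrow> e \<in> E' \<Longrightarrow>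
      (\<exists>y\<in>Q. G x e = osum D (d x y) (G2 y e)) \<or> (\<exists>a\<in>E. G x e = osum D (G1 x a) (d a e))"
proof -
  have sub: "Q \<subseteq> M" "E \<subseteq> M" using assms by auto
  interpret am: amalgamation D "P <+> E" "Q <+> E'" "sum_dist d G1" "sum_dist d G2"
  proof
    show "pseudometric D (P <+> E) (sum_dist d G1)" "pseudometric D (Q <+> E') (sum_dist d G2)"
      using bridge_imp_pseudometric G1 G2 P E sub by blast+
    show "sum_dist d G1 s t = sum_dist d G2 s t"
      if "s \<in> P <+> E" "s \<in> Q <+> E'" "t \<in> P <+> E" "t \<in> Q <+> E'" for s t
      using that agree by auto
    show "(P <+> E) \<inter> (Q <+> E') \<noteq> {}"
      using Q by auto
  qed
  obtain \<rho> where \<rho>: "pseudometric D ((P <+> E) \<union> (Q <+> E')) \<rho>"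
    and A: "\<And>s t. s \<in> P <+> E \<Longrightarrow> t \<in> P <+> E \<Longrightarrow> \<rho> s t = sum_dist d G1 s t"
    and B: "\<And>s t. s \<in> Q <+> E' \<Longrightarrow> t \<in> Q <+> E' \<Longrightarrow> \<rho> s t = sum_dist d G2 s t"
    and C: "\<And>s t. s \<in> P <+> E \<Longrightarrow> t \<in> Q <+> E' \<Longrightarrow> \<rho> s t = am.\<kappa> s t"
    using am.amalgam by blast
  have un: "(P <+> E) \<union> (Q <+> E') = P <+> E'"
    using Q E by auto
  show ?thesis
  proof
    show "bridge P E' (\<lambda>x e. \<rho> (Inl x) (Inr e))"
    proof (rule pseudometric_imp_bridge)
      show "\<rho> (Inl x) (Inl x') = d x x'" if "x \<in> P" "x' \<in> P" for x x'
        using A[of "Inl x" "Inl x'"] that by auto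
      show "\<rho> (Inr e) (Inr e') = d e e'" if "e \<in> E'" "e' \<in> E'" for e e'
        using B[of "Inr e" "Inr e'"] that by auto
    qed (use \<rho> P E un in auto)
    show "\<rho> (Inl x) (Inr e) = G1 x e" if "x \<in> P" "e \<in> E" for x e
      using A[of "Inl x" "Inr e"] that by auto
    show "\<rho> (Inl x) (Inr e) = G2 x e" if "x \<in> Q" "e \<in> E'" for x e
      using B[of "Inl x" "Inr e"] that by auto
    show "(\<exists>y\<in>Q. \<rho> (Inl x) (Inr e) = osum D (d x y) (G2 y e)) \<or>
        (\<exists>a\<in>E. \<rho> (Inl x) (Inr e) = osum D (G1 x a) (d a e))" if xe: "x \<in> P" "e \<in> E'" for x e
    proof -
      obtain c where "c \<in> P <+> E" "c \<in> Q <+> E'"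
        "\<rho> (Inl x) (Inr e) = osum D (sum_dist d G1 (Inl x) c) (sum_dist d G2 c (Inr e))"
        using am.cross_dist_attained[of "Inl x" "Inr e"] C[of "Inl x" "Inr e"] xe
        by (metis InlI InrI)
      then show ?thesis by (cases c) auto
    qed
  qed
qed

end

section \<open>The gluing of M with the used part of the target\<close>

lemma orbD:
  assumes "y \<in> orb M d t"
  shows "y \<in> M" "y \<notin> dom t" "x \<in> dom t \<Longrightarrow> d y x = the (t x)"
  using assms by (auto simp: orb_def)

text \<open>\<open>gap\<close> distils the block hypothesis: a raise from r' to r costs no more than
  any positive distance.\<close>

locale extendible_function = urysohn_space D M d
  for D and M :: "'a set" and d +
  fixes S :: "'a set" and q :: "'a \<rightharpoonup> real" and r r' :: real
  assumes extendible: "extendible_into D M d S q"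
    and rank_q: "rank q = r" and r_in: "r \<in> D"
    and dpred_r: "dpred D r = r'" and r'_pos: "0 < r'" and r'_less: "r' < r"
    and gap: "s \<in> D \<Longrightarrow> 0 < s \<Longrightarrow> r \<le> r' + s"
begin

lemma katetov_q: "katetov D M d q"
  using extendible by (simp add: extendible_into_def)

lemma dom_q: "finite (dom q)" "dom q \<noteq> {}" "dom q \<subseteq> M"
  using katetov_q by (auto simp: katetov_def)

lemma le_r': "s \<in> D \<Longrightarrow> s < r \<Longrightarrow> s \<le> r'"
  unfolding dpred_r[symmetric] dpred_def by (intro Max_ge) (auto simp: finite_D)

lemma rank_le:
  assumes "katetov D M d t" "x \<in> dom t"
  shows "rank t \<le> the (t x)"
  unfolding rank_def using assms finite_ran
  by (intro Min_le) (auto simp: katetov_def ran_def)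

text \<open>As D is finite, a finite Y admits only finitely many types. Invariance lets one
  representative decide for all points of its type.\<close>

definition type_invariant :: "'a set \<Rightarrow> 'a set \<Rightarrow> ('a \<Rightarrow> 'a \<Rightarrow> real) \<Rightarrow> bool" where
  "type_invariant Y E G \<longleftrightarrow>
     (\<forall>y\<in>M. \<forall>y'\<in>M. (\<forall>x\<in>Y. d y x = d y' x) \<longrightarrow> (\<forall>e\<in>E. G y e = G y' e))"

text \<open>The source space M and the finite part E of the target that has been used so far are glued
  along f into one pseudometric space, with cross distances G. The image of y will realise
  the distances G y to E. The set Y carries the types on which G may depend; it is temporarily
  larger than X while a new point is being added.\<close>

definition gluing ::
    "'a set \<Rightarrow> 'a set \<Rightarrow> 'a set \<Rightarrow> 'a set \<Rightarrow> ('a \<Rightarrow> 'a) \<Rightarrow> ('a \<Rightarrow> 'a \<Rightarrow> real) \<Rightarrow> bool" where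
  "gluing Y X E H f G \<longleftrightarrow>
     finite Y \<and> X \<subseteq> Y \<and> Y \<subseteq> M \<and> dom q \<subseteq> X \<and> copy_of M d H \<and> finite E \<and> E \<subseteq> H \<and>
     f ` X \<subseteq> E \<and> (\<forall>x\<in>dom q. f x = x) \<and> bridge M E G \<and> (\<forall>x\<in>X. G x (f x) = 0) \<and>
     (\<forall>y\<in>M. \<forall>e\<in>E. r' \<le> G y e \<or> (\<exists>x\<in>X. d y x \<le> G y e)) \<and>
     type_invariant Y E G"

lemma gluingD:
  assumes "gluing Y X E H f G"
  shows "finite Y" "X \<subseteq> Y" "Y \<subseteq> M" "dom q \<subseteq> X" "copy_of M d H" "finite E" "E \<subseteq> H"
    "\<And>x. x \<in> X \<Longrightarrow> f x \<in> E" "\<And>x. x \<in> dom q \<Longrightarrow> f x = x" "bridge M E G"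
    "\<And>x. x \<in> X \<Longrightarrow> G x (f x) = 0"
    "\<And>y e. y \<in> M \<Longrightarrow> e \<in> E \<Longrightarrow> r' \<le> G y e \<or> (\<exists>x\<in>X. d y x \<le> G y e)"
    and gluing_type_invariant: "type_invariant Y E G"
  using assms by (simp_all add: gluing_def image_subset_iff)

lemma gluing_same_type:
  assumes "gluing Y X E H f G" "y \<in> M" "y' \<in> M" "\<And>x. x \<in> Y \<Longrightarrow> d y x = d y' x" "e \<in> E"
  shows "G y e = G y' e"
  using gluing_type_invariant[OF assms(1)] assms(2-5) unfolding type_invariant_def by blast

lemma gluing_subset: "gluing Y X E H f G \<Longrightarrow> E \<subseteq> M"
  using gluingD(5,7) copy_subset by blast

text \<open>All realisations in H are required to lie in S because the image of y is chosen only
  later. Enlarging E without changing the old distances, or shrinking H, leaves fewer realisations,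
  so goodness persists.\<close>

definition good :: "'a set \<Rightarrow> 'a set \<Rightarrow> ('a \<Rightarrow> 'a \<Rightarrow> real) \<Rightarrow> 'a \<Rightarrow> bool" where
  "good E H G y \<longleftrightarrow> {w \<in> H. \<forall>e\<in>E. d w e = G y e} \<subseteq> S"

section \<open>Forcing a type into S\<close>

lemma good_mono:
  assumes "good E H G y" "E \<subseteq> E'" "H' \<subseteq> H" "\<And>e. e \<in> E \<Longrightarrow> G' y e = G y e"
  shows "good E' H' G' y"
  using assms unfolding good_def by (smt (verit) Collect_mono_iff subset_iff mem_Collect_eq)

text \<open>Taking the maximum with r preserves the Lipschitz condition along E and only helps the
  inequalities bounding a distance by a sum of two cross distances. Two points of Q have equal cross
  distances by type invariance. What remains is a raised y in Q against an unraised y' outside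
  Q.\<close>

lemma raised_bridge:
  assumes gl: "gluing Y X E H f G" and y0: "y0 \<in> M" and far: "\<And>x. x \<in> X \<Longrightarrow> r \<le> d y0 x"
    and Q: "Q = {y \<in> M. \<forall>x\<in>Y. d y x = d y0 x}"
  shows "bridge M E (\<lambda>y e. if y \<in> Q then max r (G y e) else G y e)"
proof -
  note g = gluingD[OF gl]
  have EM: "E \<subseteq> M" using gluing_subset[OF gl] .
  have GD: "G y e \<in> D" if "y \<in> M" "e \<in> E" for y e
    using bridgeD(1)[OF g(10)] that by blast
  have G0: "G y e = G y0 e" if "y \<in> Q" "e \<in> E" for y e
    using gluing_same_type[OF gl, of y y0 e] that y0 by (auto simp: Q)
  \<comment> \<open>By the invariant at y', either \<open>G y' e\<close> is at least r' and
    \<open>gap\<close> applies to the positive distance from y to y', or it is at least the distance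
    from y' to some x in X, and r is at most the distance from y to x.\<close>
  have key: "r \<le> d y y' + G y' e" if y: "y \<in> Q" and y': "y' \<in> M" "y' \<notin> Q" and e: "e \<in> E" for y y' e
  proof -
    have yM: "y \<in> M" and yX: "\<And>x. x \<in> X \<Longrightarrow> r \<le> d y x"
      using y far g(2) by (auto simp: Q subset_iff)
    have "y \<noteq> y'" using y y' by blast
    then have "0 < d y y'"
      using d_nonneg[OF yM y'(1)] d_eq_0[OF yM y'(1)] by linarith
    then have "r \<le> r' + d y y'"
      using gap d_in yM y'(1) by blast
    moreover have "r \<le> d y y' + d y' x" if "x \<in> X" for x
      using yX[OF that] d_triangle[of y y' x] yM y'(1) that g(2,3) by fastforce
    ultimately show ?thesis
      using g(12)[OF y'(1) e] by fastforce
  qed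
  show ?thesis
    unfolding bridge_def
  proof (intro ballI conjI)
    fix y e assume y: "y \<in> M" and e: "e \<in> E"
    show "(if y \<in> Q then max r (G y e) else G y e) \<in> D"
      using GD[OF y e] r_in by (auto simp: max_def)
    {
      fix y' assume y': "y' \<in> M"
      have "0 \<le> d y y'" using d_nonneg y y' by blast
      then show "(if y \<in> Q then max r (G y e) else G y e)
          \<le> d y y' + (if y' \<in> Q then max r (G y' e) else G y' e)"
        using bridgeD(2)[OF g(10) y e y'] key[of y y' e] G0[of y e] G0[of y' e] y' e
        by (auto simp: max_def)
      show "d y y' \<le> (if y \<in> Q then max r (G y e) else G y e)
          + (if y' \<in> Q then max r (G y' e) else G y' e)"
        using bridgeD(3)[OF g(10) y e y'] by (auto simp: max_def)
    }
    fix e' assume e': "e' \<in> E"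
    have "0 \<le> d e e'" using d_nonneg EM e e' by blast
    then show "(if y \<in> Q then max r (G y e) else G y e)
        \<le> (if y \<in> Q then max r (G y e') else G y e') + d e e'"
      using bridgeD(4)[OF g(10) y e e'] by (auto simp: max_def)
    show "d e e' \<le> (if y \<in> Q then max r (G y e) else G y e)
        + (if y \<in> Q then max r (G y e') else G y e')"
      using bridgeD(5)[OF g(10) y e e'] by (auto simp: max_def)
  qed
qed

text \<open>Over E the raised distances of \<open>y0\<close> form a Katetov function of rank r
  extending q, so extendibility provides a witness h of rank r' inside a smaller copy. Every point
  of the type Q of \<open>y0\<close> gets h as its distances to \<open>dom h\<close>, and this is
  amalgamated with the raised bridge over \<open>Q <+> E\<close>. The point z belongs to Y so that
  all of Q has the same distance to z, which is less than r.\<close>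

lemma make_good:
  assumes gl: "gluing Y X E H f G" and y0: "y0 \<in> orb M d q" and far: "\<And>x. x \<in> X \<Longrightarrow> r \<le> d y0 x"
    and z: "z \<in> Y" "d y0 z < r"
  shows "\<exists>E' H' G'. gluing Y X E' H' f G' \<and> good E' H' G' y0 \<and>
    (\<forall>y\<in>M. good E H G y \<longrightarrow> good E' H' G' y)"
proof -
  note g = gluingD[OF gl]
  have EM: "E \<subseteq> M" using gluing_subset[OF gl] .
  have y0M: "y0 \<in> M" using y0 by (rule orbD)
  define Q where "Q = {y \<in> M. \<forall>x\<in>Y. d y x = d y0 x}"
  define G1 where "G1 y e = (if y \<in> Q then max r (G y e) else G y e)" for y e
  have br1: "bridge M E G1"
    using raised_bridge[OF gl y0M far Q_def] unfolding G1_def .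
  have y0Q: "y0 \<in> Q" and QM: "Q \<subseteq> M" using y0M by (auto simp: Q_def)
  have QX: "r \<le> d y x" if "y \<in> Q" "x \<in> X" for x y
    using that far g(2) by (auto simp: Q_def)
  have G0: "G y e = G y0 e" if "y \<in> Q" "e \<in> E" for y e
    using gluing_same_type[OF gl, of y y0 e] that y0M by (auto simp: Q_def)
  define p where "p = (\<lambda>e. if e \<in> E then Some (G1 y0 e) else None)"
  have domp: "dom p = E" by (auto simp: p_def dom_def)
  have p: "p e = Some (G1 y0 e)" if "e \<in> E" for e using that by (simp add: p_def)
  have qE: "dom q \<subseteq> E" using g(4,8,9) by (metis subset_iff)
  \<comment> \<open>A point x of \<open>dom q\<close> is its own image, so \<open>G y0 x\<close> is
    the true distance q(x). It is at least r, and raising leaves it alone.\<close>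
  have q_le: "q \<subseteq>\<^sub>m p"
    unfolding map_le_def
  proof
    fix x assume x: "x \<in> dom q"
    then have xX: "x \<in> X" and xE: "x \<in> E" and xM: "x \<in> M" using g(4) qE dom_q by auto
    have "G x x = 0" using g(9)[OF x] g(11)[OF xX] by simp
    then have "G y0 x = d y0 x"
      using bridgeD(2)[OF g(10) y0M xE xM] bridgeD(3)[OF g(10) y0M xE xM] by simp
    moreover have "r \<le> d y0 x" using far xX by blast
    moreover have "d y0 x = the (q x)" using orbD(3)[OF y0 x] .
    ultimately show "q x = p x"
      using x p[OF xE] y0Q by (auto simp: G1_def)
  qed
  have G1_y0: "G1 y0 e \<in> D" "r \<le> G1 y0 e" if "e \<in> E" for e
    using bridgeD(1)[OF br1 y0M that] y0Q by (simp_all add: G1_def)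
  have kat_p: "katetov D M d p"
    unfolding katetov_def domp
  proof (intro conjI ballI)
    show "finite E" "E \<noteq> {}" "E \<subseteq> M" using g(6) dom_q qE EM by auto
    show "ran p \<subseteq> D - {0}"
      using G1_y0 r'_pos r'_less by (force simp: ran_def p_def split: if_splits)
    fix x y assume xy: "x \<in> E" "y \<in> E"
    show "\<bar>the (p x) - the (p y)\<bar> \<le> d x y" "d x y \<le> the (p x) + the (p y)"
      using bridgeD(4,5)[OF br1 y0M xy] bridgeD(4)[OF br1 y0M xy(2,1)] d_commute[of x y] xy EM
      by (auto simp: p subset_iff)
  qed
  have rank_p: "rank p = r"
    unfolding rank_def
  proof (rule Min_eqI)
    show "finite (ran p)" by (rule finite_ran) (simp add: domp g(6))
    show "r \<le> u" if "u \<in> ran p" for u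
      using that G1_y0 by (auto simp: ran_def p_def split: if_splits)
    have "ran q \<noteq> {}" using dom_q(2) by (metis domIff empty_iff equals0I not_None_eq ranI)
    moreover have "finite (ran q)" using finite_ran dom_q(1) .
    ultimately have "r \<in> ran q" using rank_q Min_in unfolding rank_def by metis
    then obtain x where "q x = Some r" by (auto simp: ran_def)
    then have "p x = Some r" using q_le by (metis domI map_le_def)
    then show "r \<in> ran p" by (rule ranI)
  qed
  have "\<exists>\<alpha>. isom_emb H d H d \<alpha> \<and> (\<forall>x\<in>dom p. \<alpha> x = x) \<and>
           (\<exists>h. katetov D M d h \<and> dom h \<subseteq> \<alpha> ` H \<and> p \<subseteq>\<^sub>m h \<and> rank h = dpred D (rank q) \<and>
                orb M d h \<inter> \<alpha> ` H \<subseteq> S)"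
  proof -
    have "copy_of M d H \<and> dom q \<subseteq> H \<and> katetov D M d p \<and> dom p \<subseteq> H \<and> q \<subseteq>\<^sub>m p \<and> rank p = rank q"
      using kat_p g(5,7) domp qE q_le rank_p rank_q by auto
    with extendible show ?thesis
      unfolding extendible_into_def by blast
  qed
  then obtain \<alpha> h where \<alpha>: "isom_emb H d H d \<alpha>"
    and h: "katetov D M d h" "dom h \<subseteq> \<alpha> ` H" "p \<subseteq>\<^sub>m h" "rank h = r'" "orb M d h \<inter> \<alpha> ` H \<subseteq> S"
    using rank_q dpred_r by blast
  define E' where "E' = dom h"
  define H' where "H' = \<alpha> ` H"
  have H': "copy_of M d H'" "H' \<subseteq> H" "H' \<subseteq> M" "E' \<subseteq> H'"
    using copy_image[OF g(5) \<alpha>] \<alpha> copy_subset h(2) by (auto simp: H'_def E'_def isom_emb_def)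
  have EE': "E \<subseteq> E'" using h(3) domp map_le_implies_dom_le E'_def by metis
  have h_ge: "r' \<le> the (h a)" if "a \<in> E'" for a
    using rank_le[OF h(1)] that h(4) by (simp add: E'_def)
  have hD: "the (h a) \<in> D" if "a \<in> E'" for a
    using that h(1) by (auto simp: katetov_def E'_def ran_def)
  have h_E: "the (h e) = G1 y0 e" if "e \<in> E" for e
    using h(3) p[OF that] domp that by (metis map_le_def option.sel)
  have h_kat: "\<bar>the (h a) - the (h a')\<bar> \<le> d a a' \<and> d a a' \<le> the (h a) + the (h a')"
    if "a \<in> E'" "a' \<in> E'" for a a'
    using h(1) that unfolding katetov_def E'_def by blast
  have br2: "bridge Q E' (\<lambda>_ a. the (h a))"
    unfolding bridge_def
  proof (intro ballI conjI)
    fix y a assume y: "y \<in> Q" and a: "a \<in> E'"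
    show "the (h a) \<in> D" using hD a .
    {
      fix y' assume y': "y' \<in> Q"
      have yM: "y \<in> M" "y' \<in> M" "z \<in> M" using y y' z g(3) by (auto simp: Q_def)
      show "the (h a) \<le> d y y' + the (h a)"
        using d_nonneg yM by simp
      \<comment> \<open>Distances less than r are at most r', so Q has diameter at most 2 r', which
        two copies of a value of h cover.\<close>
      have "d y z \<le> r'" "d y' z \<le> r'"
        using y y' z d_in[of y0 z] y0M yM(3) by (auto simp: Q_def intro: le_r')
      then show "d y y' \<le> the (h a) + the (h a)"
        using d_triangle[of y z y'] d_commute[of z y'] yM h_ge[OF a] by simp
    }
    fix a' assume a': "a' \<in> E'"
    show "the (h a) \<le> the (h a') + d a a'" "d a a' \<le> the (h a) + the (h a')"
      using h_kat[OF a a'] by auto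
  qed
  obtain G' where br: "bridge M E' G'"
    and G'E: "\<And>y e. y \<in> M \<Longrightarrow> e \<in> E \<Longrightarrow> G' y e = G1 y e"
    and G'Q: "\<And>y a. y \<in> Q \<Longrightarrow> a \<in> E' \<Longrightarrow> G' y a = the (h a)"
    and G'att: "\<And>y a. y \<in> M \<Longrightarrow> a \<in> E' \<Longrightarrow>
      (\<exists>w\<in>Q. G' y a = osum D (d y w) (the (h a))) \<or> (\<exists>e\<in>E. G' y a = osum D (G1 y e) (d e a))"
  proof (rule bridge_amalgam[OF QM _ subset_refl EE' _ br1 br2])
    show "G1 y e = the (h e)" if "y \<in> Q" "e \<in> E" for y e
      using h_E[OF that(2)] G0[OF that] y0Q that by (simp add: G1_def)
  qed (use y0Q H' in auto)
  have E'M: "E' \<subseteq> M" using H' by blast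
  \<comment> \<open>An optimal path for y is moved to y'. Through Q, its intermediate point w is
    transported to a point w' of the same type, again in Q; through E, the first leg depends only on
    the type.\<close>
  have type_le: "G' y' a \<le> G' y a"
    if y: "y \<in> M" "y' \<in> M" "\<And>x. x \<in> Y \<Longrightarrow> d y x = d y' x" and a: "a \<in> E'" for y y' a
    using G'att[OF y(1) a]
  proof
    assume "\<exists>w\<in>Q. G' y a = osum D (d y w) (the (h a))"
    then obtain w where w: "w \<in> Q" "G' y a = osum D (d y w) (the (h a))" by blast
    then have wM: "w \<in> M" using QM by blast
    obtain w' where w': "w' \<in> M" "d y' w' = d y w" "\<And>x. x \<in> Y \<Longrightarrow> d w' x = d w x"
      using same_type_transfer[OF g(1,3) y(1,2) wM y(3)] by blast
    then have "w' \<in> Q" using w(1) by (simp add: Q_def)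
    then have "G' y' a \<le> d y w + the (h a)"
      using bridgeD(2)[OF br y(2) a w'(1)] G'Q a w'(2) by simp
    then show ?thesis
      using w(2) bridgeD(1)[OF br y(2) a] by (simp add: osum_ge)
  next
    assume "\<exists>e\<in>E. G' y a = osum D (G1 y e) (d e a)"
    then obtain e where e: "e \<in> E" "G' y a = osum D (G1 y e) (d e a)" by blast
    have "y' \<in> Q \<longleftrightarrow> y \<in> Q" using y by (auto simp: Q_def)
    then have "G' y' e = G1 y e"
      using gluing_same_type[OF gl y e(1)] G'E[OF y(2) e(1)] by (simp add: G1_def)
    moreover have "e \<in> E'" using e EE' by blast
    ultimately have "G' y' a \<le> G1 y e + d e a"
      using bridgeD(4)[OF br y(2) a, of e] d_commute[of a e] E'M a by (auto simp: subset_iff)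
    then show ?thesis
      using e(2) bridgeD(1)[OF br y(2) a] by (simp add: osum_ge)
  qed
  have "gluing Y X E' H' f G'"
    unfolding gluing_def
  proof (intro conjI ballI impI)
    show "finite Y" "X \<subseteq> Y" "Y \<subseteq> M" "dom q \<subseteq> X" "copy_of M d H'" "E' \<subseteq> H'" "bridge M E' G'"
      using g H' br by auto
    show "finite E'" using h(1) by (simp add: E'_def katetov_def)
    show "f ` X \<subseteq> E'" using g(8) EE' by blast
    show "f x = x" if "x \<in> dom q" for x using g(9) that .
    \<comment> \<open>A point of X is at distance 0 < r from itself, so it is not in Q and its cross
      distances were not raised.\<close>
    show "G' x (f x) = 0" if "x \<in> X" for x
    proof -
      have xM: "x \<in> M" using that g(2,3) by blast
      then have "x \<notin> Q" using QX[of x x] that d_self r'_pos r'_less by auto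
      then show ?thesis using G'E[OF xM g(8)[OF that]] g(11)[OF that] by (simp add: G1_def)
    qed
    \<comment> \<open>A path through Q ends with a value of h, which is at least r'. A path through
      E starts with a value no smaller than the old cross distance, whose alternative carries
      over.\<close>
    show "r' \<le> G' y a \<or> (\<exists>x\<in>X. d y x \<le> G' y a)" if y: "y \<in> M" and a: "a \<in> E'" for y a
      using G'att[OF y a]
    proof
      assume "\<exists>w\<in>Q. G' y a = osum D (d y w) (the (h a))"
      then obtain w where "w \<in> Q" "G' y a = osum D (d y w) (the (h a))" by blast
      then have "the (h a) \<le> G' y a"
        using osum_ge_right d_in hD a y QM by auto
      then show ?thesis using h_ge[OF a] by simp
    next
      assume "\<exists>e\<in>E. G' y a = osum D (G1 y e) (d e a)"
      then obtain e where e: "e \<in> E" "G' y a = osum D (G1 y e) (d e a)" by blast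
      have "G1 y e \<le> G' y a"
        unfolding e(2) using bridgeD(1)[OF br1 y e(1)] d_in[of e a] e(1) EM a E'M
        by (intro osum_ge_left) auto
      moreover have "G y e \<le> G1 y e" by (simp add: G1_def)
      ultimately show ?thesis using g(12)[OF y e(1)] by fastforce
    qed
    show "type_invariant Y E' G'"
      unfolding type_invariant_def
    proof (intro ballI impI)
      fix y y' a assume "y \<in> M" "y' \<in> M" "\<forall>x\<in>Y. d y x = d y' x" "a \<in> E'"
      then show "G' y a = G' y' a"
        using type_le[of y y' a] type_le[of y' y a] by (simp add: order_antisym)
    qed
  qed
  moreover have goodQ: "good E' H' G' y" if "y \<in> Q" for y
    unfolding good_def
  proof
    fix w assume "w \<in> {w \<in> H'. \<forall>a\<in>E'. d w a = G' y a}"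
    then have w: "w \<in> H'" "\<And>a. a \<in> E' \<Longrightarrow> d w a = the (h a)"
      using G'Q[OF that] by auto
    \<comment> \<open>Membership in the orbit requires w outside \<open>dom h\<close>: inside, its
      distance 0 to itself would be a value of h, hence at least r' > 0.\<close>
    have "w \<notin> E'"
      using w(2)[of w] h_ge[of w] d_self[of w] w(1) H'(3) r'_pos by auto
    then have "w \<in> orb M d h"
      using w H'(3) by (auto simp: orb_def E'_def)
    then show "w \<in> S" using h(5) w(1) by (auto simp: H'_def)
  qed
  moreover have "good E' H' G' y" if "y \<in> M" "good E H G y" for y
  proof (cases "y \<in> Q")
    case False
    then show ?thesis
      using good_mono[OF that(2) EE' H'(2)] G'E[OF that(1)] by (simp add: G1_def)
  qed (rule goodQ)
  ultimately show ?thesis using y0Q by blast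
qed

lemma make_finitely_many_good:
  assumes "finite R" "gluing Y X E H f G" "z \<in> Y"
    and "\<And>y. y \<in> R \<Longrightarrow> y \<in> orb M d q \<and> (\<forall>x\<in>X. r \<le> d y x) \<and> d y z < r"
  shows "\<exists>E' H' G'. gluing Y X E' H' f G' \<and> (\<forall>y\<in>R. good E' H' G' y) \<and>
    (\<forall>y\<in>M. good E H G y \<longrightarrow> good E' H' G' y)"
  using assms(1,4)
proof (induction R)
  case empty
  then show ?case using assms(2) by blast
next
  case (insert y0 R)
  then obtain E1 H1 G1 where 1: "gluing Y X E1 H1 f G1" "\<forall>y\<in>R. good E1 H1 G1 y"
    "\<forall>y\<in>M. good E H G y \<longrightarrow> good E1 H1 G1 y"
    by (metis insertI2)
  have y0: "y0 \<in> orb M d q" "\<And>x. x \<in> X \<Longrightarrow> r \<le> d y0 x" "d y0 z < r"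
    using insert.prems[of y0] by auto
  obtain E2 H2 G2 where 2: "gluing Y X E2 H2 f G2" "good E2 H2 G2 y0"
    "\<forall>y\<in>M. good E1 H1 G1 y \<longrightarrow> good E2 H2 G2 y"
    using make_good[OF 1(1) y0(1,2) assms(3) y0(3)] by blast
  have "R \<subseteq> M" using insert.prems orbD(1) by fast
  then show ?case
    using 1 2 by (intro exI[of _ E2] exI[of _ H2] exI[of _ G2]) auto
qed

section \<open>Adding one point to the domain of the embedding\<close>

lemma finitely_many_types:
  assumes "finite Y" "Y \<subseteq> M" "W \<subseteq> M"
  obtains R where "finite R" "R \<subseteq> W" "\<And>y. y \<in> W \<Longrightarrow> \<exists>y0\<in>R. \<forall>x\<in>Y. d y x = d y0 x"
proof -
  let ?\<phi> = "\<lambda>y. restrict (d y) Y"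
  have "?\<phi> ` W \<subseteq> Y \<rightarrow>\<^sub>E D"
    using assms d_in by (auto simp: subset_iff)
  then have "finite (?\<phi> ` W)"
    using finite_subset finite_PiE assms(1) finite_D by metis
  then obtain R where R: "R \<subseteq> W" "finite R" "?\<phi> ` W = ?\<phi> ` R"
    using finite_subset_image[of "?\<phi> ` W" ?\<phi> W] by blast
  have "\<exists>y0\<in>R. \<forall>x\<in>Y. d y x = d y0 x" if "y \<in> W" for y
  proof -
    obtain y0 where y0: "y0 \<in> R" "?\<phi> y = ?\<phi> y0"
      using \<open>y \<in> W\<close> R(3) by blast
    then show ?thesis
      by (metis restrict_apply')
  qed
  with R that show ?thesis by blast
qed

text \<open>Only orbit points closer than r to X have been forced so far. A point of the orbit that
  enters X is at distance 0 from itself, so it is good by then.\<close>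

definition stage :: "'a set \<Rightarrow> 'a set \<Rightarrow> 'a set \<Rightarrow> ('a \<Rightarrow> 'a) \<Rightarrow> ('a \<Rightarrow> 'a \<Rightarrow> real) \<Rightarrow> bool" where
  "stage X E H f G \<longleftrightarrow> gluing X X E H f G \<and>
     (\<forall>y\<in>orb M d q. (\<exists>x\<in>X. d y x < r) \<longrightarrow> good E H G y)"

text \<open>Finer types make invariance weaker. The point z must join the types before it joins X:
  the points to be forced are close to z, whereas \<open>make_good\<close> needs them far from
  X.\<close>

lemma gluing_weaken:
  assumes "gluing X X E H f G" "z \<in> M"
  shows "gluing (insert z X) X E H f G"
proof -
  have "type_invariant (insert z X) E G"
    using gluing_type_invariant[OF assms(1)] unfolding type_invariant_def by blast
  then show ?thesis
    using gluingD[OF assms(1)] assms(2) unfolding gluing_def by auto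
qed

text \<open>The image v of z is any realisation of \<open>G z\<close> in H, and the cross distance
  from y to v is the distance from y to z. That is determined by the type because z is already among
  the points carrying types, and the lower bound for the new column holds with x = z.\<close>

lemma gluing_add_point:
  assumes gl: "gluing (insert z X) X E H f G" and zX: "z \<notin> X"
  shows "\<exists>E' f' G'. gluing (insert z X) (insert z X) E' H f' G' \<and> (\<forall>x\<in>X. f' x = f x) \<and>
    (\<forall>y\<in>M. good E H G y \<longrightarrow> good E' H G' y)"
proof -
  note g = gluingD[OF gl]
  have EM: "E \<subseteq> M" using gluing_subset[OF gl] .
  have zM: "z \<in> M" using g(3) by blast
  have XM: "X \<subseteq> M" using g(2,3) by blast
  have "\<exists>v\<in>H. \<forall>e\<in>E. d v e = G z e"
  proof (rule one_point_extension_in_copy[OF g(5,6,7)])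
    show "G z e \<in> D" if "e \<in> E" for e using bridgeD(1)[OF g(10) zM that] .
    show "\<bar>G z e - G z e'\<bar> \<le> d e e' \<and> d e e' \<le> G z e + G z e'" if "e \<in> E" "e' \<in> E" for e e'
      using bridgeD(4,5)[OF g(10) zM that] bridgeD(4)[OF g(10) zM that(2,1)]
        d_commute[of e e'] that EM by (auto simp: subset_iff)
  qed
  then obtain v where v: "v \<in> H" "\<And>e. e \<in> E \<Longrightarrow> d v e = G z e" by blast
  then have vM: "v \<in> M" using copy_subset g(5) by blast
  \<comment> \<open>Otherwise \<open>G z v\<close> = 0, and the invariant would give r' <= 0 or put
    z at distance 0 from a point of X.\<close>
  have vE: "v \<notin> E"
  proof
    assume vE: "v \<in> E"
    then have "G z v = 0" using v(2) d_self vM by metis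
    moreover have "d z x \<noteq> 0" if "x \<in> X" for x
      using d_eq_0[OF zM] that XM zX by blast
    ultimately show False
      using g(12)[OF zM vE] r'_pos d_nonneg[OF zM] XM by (metis not_le order_antisym subsetD)
  qed
  define G' where "G' y e = (if e = v then d y z else G y e)" for y e
  have G'v: "G' y v = d y z" for y by (simp add: G'_def)
  have G'E: "G' y e = G y e" if "e \<in> E" for y e using that vE by (auto simp: G'_def)
  have "bridge M (insert v E) G'"
    unfolding bridge_def
  proof (intro ballI conjI)
    fix y e assume y: "y \<in> M" and e: "e \<in> insert v E"
    show "G' y e \<in> D"
      using e bridgeD(1)[OF g(10) y] d_in[OF y zM] by (auto simp: G'v G'E)
    {
      fix y' assume y': "y' \<in> M"
      show "G' y e \<le> d y y' + G' y' e" "d y y' \<le> G' y e + G' y' e"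
        using e bridgeD(2,3)[OF g(10) y _ y'] d_triangle[OF y y' zM] d_triangle[OF y zM y']
          d_commute[OF y' zM] by (auto simp: G'v G'E)
    }
    fix e' assume e': "e' \<in> insert v E"
    have a: "d y z \<le> G y a + G z a" "G y a \<le> d y z + G z a" "G z a \<le> G y a + d y z" "G z a \<le> d y z + G y a"
      "d v a = G z a" "d a v = G z a" if "a \<in> E" for a
      using bridgeD(2,3)[OF g(10) y that zM] bridgeD(2)[OF g(10) zM that y] v(2)[OF that]
        d_commute[OF zM y] d_commute[OF vM, of a] EM that by auto
    show "G' y e \<le> G' y e' + d e e'" "d e e' \<le> G' y e + G' y e'"
      using e e' bridgeD(4,5)[OF g(10) y] a d_self[OF vM] d_nonneg[OF y zM]
      by (auto simp: G'v G'E)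
  qed
  moreover have "type_invariant (insert z X) (insert v E) G'"
    unfolding type_invariant_def
  proof (intro ballI impI)
    fix y y' e
    assume y: "y \<in> M" "y' \<in> M" and type: "\<forall>x\<in>insert z X. d y x = d y' x"
      and e: "e \<in> insert v E"
    show "G' y e = G' y' e"
      using e
    proof
      assume "e \<in> E"
      then have "G y e = G y' e"
        using gluing_same_type[OF gl y] type by blast
      then show ?thesis using \<open>e \<in> E\<close> by (simp add: G'E)
    qed (use type in \<open>simp add: G'v\<close>)
  qed
  ultimately have "gluing (insert z X) (insert z X) (insert v E) H (f(z := v)) G'"
    unfolding gluing_def
  proof (intro conjI ballI)
    show "finite (insert z X)" "insert z X \<subseteq> insert z X" "insert z X \<subseteq> M" "dom q \<subseteq> insert z X"
      "copy_of M d H" "finite (insert v E)" "insert v E \<subseteq> H"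
      using g v by auto
    show "(f(z := v)) ` insert z X \<subseteq> insert v E" using g(8) by auto
    show "(f(z := v)) x = x" if "x \<in> dom q" for x using that g(4,9) zX by auto
    show "G' x ((f(z := v)) x) = 0" if "x \<in> insert z X" for x
      using that g(8,11) G'v G'E d_self[OF zM] by auto
    show "r' \<le> G' y e \<or> (\<exists>x\<in>insert z X. d y x \<le> G' y e)" if "y \<in> M" "e \<in> insert v E" for y e
      using that(2)
    proof
      assume "e \<in> E"
      then show ?thesis using g(12)[OF that(1), of e] by (auto simp: G'E)
    qed (simp add: G'v)
  qed
  moreover have "good (insert v E) H G' y" if "good E H G y" for y
    using good_mono[OF that] G'E by blast
  ultimately show ?thesis
    using zX by (intro exI[of _ "insert v E"] exI[of _ "f(z := v)"] exI[of _ G']) auto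
qed

lemma stage_step:
  assumes st: "stage X E H f G" and z: "z \<in> M"
  shows "\<exists>E' H' f' G'. stage (insert z X) E' H' f' G' \<and> (\<forall>x\<in>X. f' x = f x)"
proof (cases "z \<in> X")
  case True
  then show ?thesis using st by (metis insert_absorb)
next
  case False
  have gl: "gluing (insert z X) X E H f G"
    using st z gluing_weaken by (simp add: stage_def)
  \<comment> \<open>The orbit points that first come closer than r to the domain when z is added;
    those close to X are good already and stay good.\<close>
  define W where "W = {y \<in> orb M d q. (\<forall>x\<in>X. r \<le> d y x) \<and> d y z < r}"
  have WM: "W \<subseteq> M" using orbD(1) by (fastforce simp: W_def)
  obtain R where R: "finite R" "R \<subseteq> W"
    "\<And>y. y \<in> W \<Longrightarrow> \<exists>y0\<in>R. \<forall>x\<in>insert z X. d y x = d y0 x"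
    using finitely_many_types[OF gluingD(1,3)[OF gl] WM] by blast
  obtain E1 H1 G1 where 1: "gluing (insert z X) X E1 H1 f G1" "\<forall>y\<in>R. good E1 H1 G1 y"
    "\<forall>y\<in>M. good E H G y \<longrightarrow> good E1 H1 G1 y"
    using make_finitely_many_good[OF R(1) gl insertI1] R(2) unfolding W_def by blast
  have good1: "good E1 H1 G1 y" if y: "y \<in> orb M d q" "x \<in> insert z X" "d y x < r" for x y
  proof (cases "\<exists>x\<in>X. d y x < r")
    case True
    then show ?thesis using st y(1) 1(3) orbD(1) by (fastforce simp: stage_def)
  next
    case False
    then have yW: "y \<in> W" using y by (force simp: W_def)
    then obtain y0 where y0: "y0 \<in> R" "\<And>x. x \<in> insert z X \<Longrightarrow> d y x = d y0 x"
      using R(3) by blast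
    then have "G1 y e = G1 y0 e" if "e \<in> E1" for e
      using gluing_same_type[OF 1(1), of y y0 e] that yW R(2) WM by blast
    then show ?thesis using good_mono[of E1 H1 G1 y0 E1 H1 G1] 1(2) y0(1) unfolding good_def by auto
  qed
  obtain E2 f2 G2 where 2: "gluing (insert z X) (insert z X) E2 H1 f2 G2" "\<forall>x\<in>X. f2 x = f x"
    "\<forall>y\<in>M. good E1 H1 G1 y \<longrightarrow> good E2 H1 G2 y"
    using gluing_add_point[OF 1(1) False] by blast
  have "stage (insert z X) E2 H1 f2 G2"
    unfolding stage_def
  proof (intro conjI ballI impI)
    fix y assume y: "y \<in> orb M d q" "\<exists>x\<in>insert z X. d y x < r"
    then have "good E1 H1 G1 y" using good1 by blast
    then show "good E2 H1 G2 y" using 2(3) orbD(1)[OF y(1)] by blast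
  qed (rule 2(1))
  then show ?thesis using 2(2) by blast
qed

text \<open>As q has rank r, no orbit point is closer than r to \<open>dom q\<close>, so nothing has
  to be forced yet. The lower bound holds with x = e.\<close>

lemma stage_initial: "stage (dom q) (dom q) M id d"
proof -
  have "bridge M (dom q) d"
    unfolding bridge_def
  proof (intro ballI conjI)
    fix x e assume x: "x \<in> M" and "e \<in> dom q"
    then have e: "e \<in> M" using dom_q by blast
    show "d x e \<in> D" using d_in x e .
    show "d x e \<le> d x x' + d x' e" "d x x' \<le> d x e + d x' e" if "x' \<in> M" for x'
      using d_triangle[OF x that e] d_triangle[OF x e that] d_commute[OF e that] by auto
    show "d x e \<le> d x e' + d e e'" "d e e' \<le> d x e + d x e'" if "e' \<in> dom q" for e'
      using d_triangle[OF x _ e, of e'] d_triangle[OF e x, of e'] d_commute[OF e, of e']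
        d_commute[OF e x] that dom_q by auto
  qed
  moreover have "type_invariant (dom q) (dom q) d"
    by (simp add: type_invariant_def)
  ultimately have "gluing (dom q) (dom q) (dom q) M id d"
    using dom_q copy_self d_self by (auto simp: gluing_def)
  moreover have "r \<le> d y x" if "y \<in> orb M d q" "x \<in> dom q" for x y
    using orbD(3)[OF that] rank_le[OF katetov_q that(2)] rank_q by simp
  ultimately show ?thesis by (fastforce simp: stage_def)
qed

text \<open>Since \<open>G x (f x)\<close> = 0, the triangle inequalities identify the distances of
  \<open>f x\<close> to E with \<open>G x\<close>. So \<open>f x\<close> is a realisation of
  \<open>G x\<close> in H, and goodness of an orbit point x puts it in S.\<close>

lemma stage_isometry:
  assumes "stage X E H f G" "x \<in> X" "y \<in> X"
  shows "f x \<in> M" "d (f x) (f y) = d x y" and "x \<in> dom q \<Longrightarrow> f x = x"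
    and "x \<in> orb M d q \<Longrightarrow> f x \<in> S"
proof -
  have gl: "gluing X X E H f G" using assms(1) by (simp add: stage_def)
  note g = gluingD[OF gl]
  have M: "x \<in> M" "y \<in> M" "E \<subseteq> M" using assms g(3) gluing_subset[OF gl] by auto
  have f: "f x \<in> E" "f y \<in> E" "G x (f x) = 0" "G y (f y) = 0" using g(8,11) assms by auto
  show "f x \<in> M" using f M by blast
  show "x \<in> dom q \<Longrightarrow> f x = x" by (rule g(9))
  have eq: "d (f x) e = G x e" if "e \<in> E" for e
    using bridgeD(4,5)[OF g(10) M(1) f(1) that] bridgeD(4)[OF g(10) M(1) that f(1)] f(3)
      d_commute[of e "f x"] f(1) that M(3) by (simp add: subset_iff)
  have "G x (f y) = d x y"
    using bridgeD(2,3)[OF g(10) M(1) f(2) M(2)] f(4) by auto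
  then show "d (f x) (f y) = d x y" using eq f(2) by simp
  assume x: "x \<in> orb M d q"
  have "d x x < r" using d_self M(1) r'_pos r'_less by simp
  then have "good E H G x" using assms(1,2) x unfolding stage_def by blast
  then show "f x \<in> S" using f(1) g(7) eq unfolding good_def by auto
qed

section \<open>The limit of the stages\<close>

lemma copy_with_orbit_in: "\<exists>C. copy_of M d C \<and> dom q \<subseteq> C \<and> orb M d q \<inter> C \<subseteq> S"
proof -
  define en where "en = from_nat_into M"
  have en: "range en = M"
    unfolding en_def using M_nonempty in_U by (intro range_from_nat_into) (auto simp: in_U_def)
  define P where "P s = (case s of (X, E, H, f, G) \<Rightarrow> stage X E H f G)" for s
  define T where "T n s s' = (case (s, s') of ((X, E, H, f, G), (X', E', H', f', G')) \<Rightarrow>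
    X' = insert (en n) X \<and> (\<forall>x\<in>X. f' x = f x))"
    for n and s s' :: "'a set \<times> 'a set \<times> 'a set \<times> ('a \<Rightarrow> 'a) \<times> ('a \<Rightarrow> 'a \<Rightarrow> real)"
  have "\<exists>s. \<forall>n. P (s n) \<and> T n (s n) (s (Suc n))"
  proof (rule dependent_nat_choice)
    show "\<exists>s. P s"
      using stage_initial by (intro exI[of _ "(dom q, dom q, M, id, d)"]) (simp add: P_def)
    fix s n assume "P s"
    then obtain X E H f G where s: "s = (X, E, H, f, G)" "stage X E H f G"
      by (cases s) (auto simp: P_def)
    have "en n \<in> M" using en by blast
    then obtain E' H' f' G' where "stage (insert (en n) X) E' H' f' G'" "\<forall>x\<in>X. f' x = f x"
      using stage_step[OF s(2)] by blast
    then show "\<exists>s'. P s' \<and> T n s s'"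
      using s(1) by (intro exI[of _ "(insert (en n) X, E', H', f', G')"]) (simp add: P_def T_def)
  qed
  then obtain s where s: "P (s n)" "T n (s n) (s (Suc n))" for n
    by blast
  define X where "X n = fst (s n)" for n
  define f where "f n = fst (snd (snd (snd (s n))))" for n
  have st: "\<exists>E H G. stage (X n) E H (f n) G" for n
    using s(1)[of n] by (auto simp: P_def X_def f_def split: prod.splits)
  have step: "X (Suc n) = insert (en n) (X n)" "\<And>x. x \<in> X n \<Longrightarrow> f (Suc n) x = f n x" for n
    using s(2)[of n] by (auto simp: T_def X_def f_def split: prod.splits)
  have mono: "X m \<subseteq> X n \<and> (\<forall>x\<in>X m. f n x = f m x)" if "m \<le> n" for m n
    using that by (induction rule: dec_induct) (auto simp: step)
  define idx where "idx x = (LEAST n. x \<in> X n)" for x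
  \<comment> \<open>The value at x never changes after x has entered the domain, so the first such
    stage decides it.\<close>
  define F where "F x = f (idx x) x" for x
  have idx: "x \<in> X (idx x)" if xM: "x \<in> M" for x
  proof -
    obtain n where "x = en n" using xM en by blast
    then have "x \<in> X (Suc n)" using step by simp
    then show ?thesis unfolding idx_def by (rule LeastI)
  qed
  have F: "F x = f n x" "x \<in> X n" if "x \<in> M" "idx x \<le> n" for x n
    using mono[OF that(2)] idx[OF that(1)] by (auto simp: F_def)
  have iso: "F x \<in> M" "d (F x) (F y) = d x y" "x \<in> dom q \<Longrightarrow> F x = x" "x \<in> orb M d q \<Longrightarrow> F x \<in> S"
    if xy: "x \<in> M" "y \<in> M" for x y
  proof -
    define n where "n = max (idx x) (idx y)"
    have n: "F x = f n x" "x \<in> X n" "F y = f n y" "y \<in> X n"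
      using F[OF xy(1), of n] F[OF xy(2), of n] by (auto simp: n_def)
    obtain E H G where "stage (X n) E H (f n) G" using st by blast
    note i = stage_isometry[OF this n(2,4)]
    show "F x \<in> M" "d (F x) (F y) = d x y" "x \<in> dom q \<Longrightarrow> F x = x" "x \<in> orb M d q \<Longrightarrow> F x \<in> S"
      using i n by auto
  qed
  have "isom_emb M d M d F"
    using iso by (auto simp: isom_emb_def)
  then have "copy_of M d (F ` M)" by (auto simp: copy_of_def)
  moreover have "dom q \<subseteq> F ` M"
  proof
    fix x assume x: "x \<in> dom q"
    then have "x \<in> M" using dom_q by blast
    then show "x \<in> F ` M" using iso(3)[OF _ _ x] by (metis image_eqI)
  qed
  \<comment> \<open>F is an isometry fixing \<open>dom q\<close>, so an image in the orbit comes
    from a point y of the orbit, and the stages have sent such y into S.\<close>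
  moreover have "F y \<in> S" if y: "y \<in> M" "F y \<in> orb M d q" for y
  proof (rule iso(4)[OF y(1) y(1)])
    have "d y x = the (q x)" if "x \<in> dom q" for x
    proof -
      have x: "x \<in> M" "F x = x" using dom_q that iso(3) by auto
      show ?thesis using iso(2)[OF y(1) x(1)] x(2) orbD(3)[OF y(2) that] by simp
    qed
    moreover have "y \<notin> dom q" using iso(3)[OF y(1) y(1)] orbD(2)[OF y(2)] by metis
    ultimately show "y \<in> orb M d q" using y(1) by (simp add: orb_def)
  qed
  ultimately show ?thesis by (intro exI[of _ "F ` M"]) auto
qed

end

section \<open>Arithmetic of the block of 1, and the theorem\<close>

lemma block_gap:
  assumes D: "finite D" "0 \<in> D" "\<forall>x\<in>D. 0 \<le> x" "Min (D - {0}) = 1"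
    and B: "is_block D B" "1 \<in> B" and r: "r \<in> B" "1 < r"
  shows "dpred D r \<in> D" "1 \<le> dpred D r" "dpred D r < r" "r \<le> dpred D r + 1"
proof -
  define p where "p = dpred D r"
  have BD: "B \<subseteq> D - {0}" "finite B" using B by (auto simp: is_block_def)
  have ge1: "1 \<le> x" if "x \<in> D" "x \<noteq> 0" for x
    using Min_le[of "D - {0}" x] D(1,4) that by simp
  have "p \<in> {s \<in> D. s < r}"
    unfolding p_def dpred_def using D r by (intro Max_in) auto
  moreover have "1 \<le> p"
    unfolding p_def dpred_def using D(1) B(2) BD r by (intro Max_ge) auto
  ultimately have p: "p \<in> D" "1 \<le> p" "p < r" by auto
  then show "dpred D r \<in> D" "1 \<le> dpred D r" "dpred D r < r" by (simp_all add: p_def)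
  have MinB: "Min B = 1"
    using B(2) BD ge1 by (intro Min_eqI) auto
  \<comment> \<open>The predecessor p lies between \<open>Min B\<close> = 1 and
    \<open>Max B\<close>, so it belongs to the block, and as p < \<open>Max B\<close> the step
    condition bounds its successor by p + 1.\<close>
  have rB: "r \<le> Max B" using r BD by simp
  then have pB: "p \<in> B"
    using B(1) p MinB by (simp add: is_block_def)
  have "dsucc D p \<le> p + 1"
    using B(1) pB p rB MinB by (auto simp: is_block_def)
  \<comment> \<open>No element of D lies strictly between p and r.\<close>
  moreover have "r \<le> dsucc D p"
  proof -
    have rD: "r \<in> D" using r BD by blast
    then have "p \<noteq> Max D" using Max_ge[OF D(1) rD] p by auto
    moreover have "r \<le> s" if "s \<in> D" "p < s" for s
    proof (rule ccontr)
      assume "\<not> r \<le> s"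
      then have "s \<le> p" unfolding p_def dpred_def using D(1) that by (intro Max_ge) auto
      with that show False by simp
    qed
    ultimately show ?thesis
      using D(1) rD p by (auto simp: dsucc_def intro!: Min.boundedI)
  qed
  ultimately show "r \<le> dpred D r + 1" by (simp add: p_def)
qed

theorem theorem7p1:
  fixes D :: "real set" and M :: "'a set" and d :: "'a \<Rightarrow> 'a \<Rightarrow> real"
    and S :: "'a set" and B :: "real set" and r :: real and q :: "'a \<rightharpoonup> real"
  assumes "finite D" and "0 \<in> D" and "\<forall>x\<in>D. x \<ge> 0"
    and "universal_dset D"
    and "Min (D - {0}) = 1"
    and "is_block D B" and "1 \<in> B"
    and "in_U D M d"
    and "S \<subseteq> M"
    and "r \<in> B" and "r > 1"
    and "katetov D M d q" and "rank q = r"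
    and "extendible_into D M d S q"
  shows "\<exists>C. copy_of M d C \<and> dom q \<subseteq> C \<and> orb M d q \<inter> C \<subseteq> S"
proof -
  note gap = block_gap[OF assms(1,2,3,5,6,7,10,11)]
  interpret extendible_function D M d S q r "dpred D r"
  proof
    show "r \<in> D" using assms(6,10) by (auto simp: is_block_def)
    show "r \<le> dpred D r + s" if "s \<in> D" "0 < s" for s
      using Min_le[of "D - {0}" s] assms(1,5) that gap(4) by simp
  qed (use assms gap in auto)
  show ?thesis by (rule copy_with_orbit_in)
qed

end
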